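(* Let $\mathcal{M}$ be a 3-dimensional manifold with local coordinates $x=(x^1,x^2,x^3)$ and consider the driftless system $$\dot x = g_1(x)u^1+g_2(x)u^2,\qquad x(0)=x_0,$$ with smooth vector fields $g_1,g_2$, assumed to be $x$-flat with $x$-flat output $\varphi=(\varphi^1,\varphi^2)$, where $L_{g_2}\varphi^i=0$ for $i=1,2$. Let $\mathcal{I}=[0,T]$, $y_d\in C^\infty(\mathcal{I},\mathbb{R}^2)$, $e^i=y_d^i-\varphi^i(x)$, $\dot e^i=\dot y_d^i-L_{g_1}\varphi^i\,u^1$. Let $\bar Q,Q,M$ be constant symmetric positive definite $2\times2$ matrices with $[M^{lm}]=M^{-1}$ and $$Q_{ij}=\bar Q_{il}M^{lm}\bar Q_{mj}.$$ Consider the fixed-time, free-endpoint optimal control problem of minimizing $$J(u)=\tfrac12 e^i\bar Q_{ij}e^j\Big|_{t=T}+\int_0^T\tfrac12\big(e^iQ_{ij}e^j+\dot e^iM_{ij}\dot e^j\big)\,dt$$ subject to the system dynamics and $|u^a|\le u^a_{\max}$, $a=1,2$. Then, provided $u^1\neq0$, an optimal solution candidate is given by $$u^1=\begin{cases}\operatorname{sgn}(u^1_{\mathrm{sing}})\,u^1_{\max},&|u^1_{\mathrm{sing}}|\ge u^1_{\max},\\ u^1_{\mathrm{sing}},&\text{otherwise,}\end{cases}$$ $$u^2=\begin{cases}\operatorname{sgn}(\dot\xi_2)\,u^2_{\max},&\dot\xi_2\neq0,\\ \operatorname{sgn}(u^2_{\mathrm{sing}})\,u^2_{\max},&|u^2_{\mathrm{sing}}|\ge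 u^2_{\max}\text{ and }\dot\xi_2=0,\\ u^2_{\mathrm{sing}},&\text{otherwise,}\end{cases}$$ with $$u^1_{\mathrm{sing}}=\frac{\big[\dot y_d^iM_{ij}+e^i\bar Q_{ij}\big]L_{g_1}\varphi^j}{A_{11}},\qquad u^2_{\mathrm{sing}}=\frac{A_{11}b_2-A_{21}b_1}{(A_{12}A_{21}-A_{11}A_{22})\,u^1},$$ where $$A_{11}=L_{g_1}\varphi^iM_{ij}L_{g_1}\varphi^j,\quad A_{12}=L_{[g_1,g_2]}\varphi^iM_{ij}L_{g_1}\varphi^j,\quad A_{21}=L_{g_1}\varphi^iM_{ij}L_{[g_1,g_2]}\varphi^j,\quad A_{22}=L_{[g_1,g_2]}\varphi^iM_{ij}L_{[g_1,g_2]}\varphi^j,$$ $$b_1=\big((\ddot y_d^i-L_{g_1}^2\varphi^i\,(u^1)^2)M_{ij}-e^iQ_{ij}\big)L_{g_1}\varphi^j,\qquad b_2=\big((\ddot y_d^i-L_{g_1}^2\varphi^i\,(u^1)^2)M_{ij}-e^iQ_{ij}\big)L_{[g_1,g_2]}\varphi^j .$$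
   Context: The Einstein summation convention is used; $L_g\varphi=g^k\partial_{x^k}\varphi$ is the Lie derivative, $L_g^2\varphi=L_g(L_g\varphi)$, and $[g_1,g_2]^k=g_1^l\partial_{x^l}g_2^k-g_2^l\partial_{x^l}g_1^k$ is the Lie bracket. Flatness. A system $\dot x=f(x,u)$ with $m$ inputs is $x$-flat if there is an $m$-tuple $y=\varphi(x)$ (the $x$-flat output) such that $(x,u)=F(y,\dot y,\dots,y^{(r)})$ for some smooth $F$. All considerations are local. For the system considered here, $x$-flatness is equivalent to local equivalence, by a state transformation and a static input transformation, to the chained form $\dot z^1=v^1,\ \dot z^2=z^3v^1,\ \dot z^3=v^2$ with flat output $(z^1,z^2)$. After a static input transformation it is assumed that $L_{g_2}\varphi^i=0$, $i=1,2$. Flatness then gives that $g_1,g_2,[g_1,g_2]$ span the tangent space and that $$\det\begin{bmatrix}L_{g_1}\varphi^1&L_{[g_1,g_2]}\varphi^1\\ L_{g_1}\varphi^2&L_{[g_1,g_2]}\varphi^2\end{bmatrix}\neq0 .$$ Necessary conditions. The Hamiltonian is $H=\tfrac12(e^iQ_{ij}e^j+\dot e^iM_{ij}\dot e^j)+\lambda_lg_a^lu^a$. The costate satisfies $$\dot\lambda_k=e^iQ_{ij}\partial_{x^k}\varphi^j+\dot e^iM_{ij}\,\partial_{x^k}(L_{g_1}\varphi^j)\,u^1-\lambda_l\,\partial_{x^k}g_a^l\,u^a,\qquad \lambda_k\big|_{t=T}=-e^i\bar Q_{ij}\partial_{x^k}\varphi^j\big|_{t=T}.$$ Put $\xi_1=\partial_{u^1}H=-\dot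 e^iM_{ij}L_{g_1}\varphi^j+\lambda_lg_1^l$ and $\xi_2=\partial_{u^2}H=\lambda_lg_2^l$ (the switching function; $H$ is affine in $u^2$). The quantity $\dot\xi_2$ in the claim is $$\dot\xi_2=\big[-\dot e^iM_{ij}L_{[g_1,g_2]}\varphi^j+\lambda_l[g_1,g_2]^l\big]u^1,$$ evaluated with the closed-form costate $\lambda_k=-e^i\bar Q_{ij}\partial_{x^k}\varphi^j$. The singular manifold is $\{\xi_2=\dot\xi_2=0\}$; a singular arc is a nontrivial time interval on which $\xi_1=0$, $\xi_2\equiv0$ and the successive time derivatives of $\xi_2$ vanish. Optimal solution candidate. A control is called an optimal solution candidate if it meets the necessary conditions of Pontryagin's maximum principle: on the singular arc, with inputs in the interior of the bounds, the stationarity condition $\xi_1=0$, the conditions $\xi_2=\dot\xi_2=\ddot\xi_2=0$, the strengthened Legendre–Clebsch condition $\partial^2_{u^1u^1}H>0$ and the strengthened generalized Legendre–Clebsch condition $-\partial_{u^2}\ddot\xi_2>0$ for the singular input; otherwise the respective input is taken on the boundary of the admissible set. *)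

theory Defs
  imports "HOL-Analysis.Analysis"
begin

section \<open>Differential-geometric notation in local coordinates\<close>

definition pd :: "'n::finite \<Rightarrow> (real^'n \<Rightarrow> real) \<Rightarrow> real^'n \<Rightarrow> real" where
  "pd k h x = deriv (\<lambda>s. h (x + s *\<^sub>R axis k 1)) 0"

definition lie :: "(real^'n::finite \<Rightarrow> real^'n) \<Rightarrow> (real^'n \<Rightarrow> real) \<Rightarrow> real^'n \<Rightarrow> real" where
  "lie g h x = (\<Sum>k\<in>UNIV. g x $ k * pd k h x)"

text \<open>The componentwise versions for a tuple \<open>\<phi>\<close> of functions.\<close>

definition pds :: "'n::finite \<Rightarrow> (real^'n \<Rightarrow> real^'m::finite) \<Rightarrow> real^'n \<Rightarrow> real^'m" where
  "pds k \<phi> x = (\<chi> j. pd k (\<lambda>z. \<phi> z $ j) x)"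

definition lies :: "(real^'n::finite \<Rightarrow> real^'n) \<Rightarrow> (real^'n \<Rightarrow> real^'m::finite) \<Rightarrow> real^'n \<Rightarrow> real^'m" where
  "lies g \<phi> x = (\<chi> j. lie g (\<lambda>z. \<phi> z $ j) x)"

definition bracket :: "(real^'n::finite \<Rightarrow> real^'n) \<Rightarrow> (real^'n \<Rightarrow> real^'n) \<Rightarrow> real^'n \<Rightarrow> real^'n" where
  "bracket g h x = (\<chi> k. \<Sum>l\<in>UNIV. g x $ l * pd l (\<lambda>z. h z $ k) x - h x $ l * pd l (\<lambda>z. g z $ k) x)"

text \<open>The bilinear form \<open>v\<^sup>i A\<^sub>i\<^sub>j w\<^sup>j\<close>.\<close>

definition bil :: "real^'m::finite^'m \<Rightarrow> real^'m \<Rightarrow> real^'m \<Rightarrow> real" where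
  "bil A v w = v \<bullet> (A *v w)"

definition sym_pos_def :: "real^'m::finite^'m \<Rightarrow> bool" where
  "sym_pos_def A \<longleftrightarrow> transpose A = A \<and> (\<forall>v. v \<noteq> 0 \<longrightarrow> bil A v v > 0)"

text \<open>Derivatives are taken within \<open>S\<close>, so on a nondegenerate compact interval they are one-sided
  at the end points, and on an open set they are the ordinary derivatives.\<close>

primrec Ck_on :: "nat \<Rightarrow> ('a::real_normed_vector \<Rightarrow> 'b::real_normed_vector) \<Rightarrow> 'a set \<Rightarrow> bool" where
  "Ck_on 0 f S \<longleftrightarrow> continuous_on S f"
| "Ck_on (Suc k) f S \<longleftrightarrow>
     (\<exists>f'. (\<forall>x\<in>S. (f has_derivative f' x) (at x within S)) \<and> (\<forall>v. Ck_on k (\<lambda>x. f' x v) S))"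

definition smooth_on :: "'a::real_normed_vector set \<Rightarrow> ('a \<Rightarrow> 'b::real_normed_vector) \<Rightarrow> bool" where
  "smooth_on S f \<longleftrightarrow> (\<forall>k. Ck_on k f S)"


section \<open>Flatness\<close>

text \<open>An element \<open>z\<close> of \<open>nat \<Rightarrow> real^'m\<close> stands for the jet \<open>(y, y', y'', \<dots>)\<close>. Maps of the
  \<open>r\<close>-jet are maps on this type that are only applied to jets truncated after order \<open>r\<close>; smoothness
  is the existence and continuity of all iterated partial derivatives.\<close>

primrec Ck_jet :: "nat \<Rightarrow> ((nat \<Rightarrow> real^'m::finite) \<Rightarrow> 'b::real_normed_vector) \<Rightarrow> (nat \<Rightarrow> real^'m) set \<Rightarrow> bool" where
  "Ck_jet 0 F W \<longleftrightarrow> continuous_on W F"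
| "Ck_jet (Suc k) F W \<longleftrightarrow> continuous_on W F \<and>
     (\<forall>j i. \<exists>F'. (\<forall>z\<in>W. ((\<lambda>s. F (z(j := z j + s *\<^sub>R axis i 1))) has_vector_derivative F' z) (at 0))
        \<and> Ck_jet k F' W)"

definition jet :: "nat \<Rightarrow> (real \<Rightarrow> real^'m::finite) \<Rightarrow> real \<Rightarrow> (nat \<Rightarrow> real^'m)" where
  "jet r y t = (\<lambda>k. if k \<le> r then ((\<lambda>h s. vector_derivative h (at s)) ^^ k) y t else 0)"

definition smooth_solution ::
  "(real^'n::finite) set \<Rightarrow> (real^'n \<Rightarrow> real^'m::finite \<Rightarrow> real^'n) \<Rightarrow> real set
     \<Rightarrow> (real \<Rightarrow> real^'n) \<Rightarrow> (real \<Rightarrow> real^'m) \<Rightarrow> bool" where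
  "smooth_solution U f J x u \<longleftrightarrow> smooth_on J x \<and> smooth_on J u \<and>
     (\<forall>t\<in>J. x t \<in> U \<and> (x has_vector_derivative f (x t) (u t)) (at t))"

text \<open>\<open>x\<close>-flatness of \<open>x' = f(x,u)\<close>, locally around every state in \<open>U\<close>: near some point
  \<open>(x\<^sub>0,u\<^sub>0)\<close> over \<open>x\<^sub>0\<close>, and near the jet of \<open>y = \<phi>(x)\<close> along some solution through it, state and
  input are a smooth function \<open>F\<close> of \<open>y, y', \<dots>, y\<^sup>(\<^sup>r\<^sup>)\<close>. As the flat output has as many
  components as the input, both are indexed by \<open>'m\<close>. An input \<open>u\<^sub>0\<close> has to be singled out because
  \<open>F\<close> typically has singularities (such as \<open>u\<^sup>1 = 0\<close> for the chained form).\<close>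

definition x_flat ::
  "(real^'n::finite) set \<Rightarrow> (real^'n \<Rightarrow> real^'m::finite \<Rightarrow> real^'n) \<Rightarrow> (real^'n \<Rightarrow> real^'m) \<Rightarrow> bool" where
  "x_flat U f \<phi> \<longleftrightarrow> (\<forall>x0\<in>U. \<exists>u0 r N W. \<exists>F :: (nat \<Rightarrow> real^'m) \<Rightarrow> (real^'n) \<times> (real^'m).
     open N \<and> (x0, u0) \<in> N \<and> open W \<and> (\<forall>k. Ck_jet k F W) \<and>
     (\<exists>a b x u. a < 0 \<and> 0 < b \<and> smooth_solution U f {a<..<b} x u \<and> x 0 = x0 \<and> u 0 = u0
        \<and> jet r (\<lambda>s. \<phi> (x s)) 0 \<in> W) \<and>
     (\<forall>a b x u. smooth_solution U f {a<..<b} x u \<longrightarrow>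
        (\<forall>t\<in>{a<..<b}. (x t, u t) \<in> N \<and> jet r (\<lambda>s. \<phi> (x s)) t \<in> W
           \<longrightarrow> F (jet r (\<lambda>s. \<phi> (x s)) t) = (x t, u t))))"


text \<open>For a driftless system with inputs \<open>u\<^sup>1, u\<^sup>2\<close> and \<open>L\<^sub>g\<^sub>2 \<phi> = 0\<close>, flatness entails that
  \<open>L\<^sub>g\<^sub>1 \<phi>\<close> and \<open>L\<^sub>[\<^sub>g\<^sub>1\<^sub>,\<^sub>g\<^sub>2\<^sub>] \<phi>\<close> are linearly independent. This regularity of the coordinate domain
  is used as a standing condition next to \<open>x_flat\<close>.\<close>


section \<open>The optimal control problem\<close>

record ocp =
  g1 :: "real^3 \<Rightarrow> real^3"
  g2 :: "real^3 \<Rightarrow> real^3"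
  phi :: "real^3 \<Rightarrow> real^2"
  yd :: "real \<Rightarrow> real^2"
  Qbar :: "real^2^2"
  Qrun :: "real^2^2"
  Mrun :: "real^2^2"
  horizon :: real
  umax :: "real^2"

definition sys :: "ocp \<Rightarrow> real^3 \<Rightarrow> real^2 \<Rightarrow> real^3" where
  "sys P x u = u $ 1 *\<^sub>R g1 P x + u $ 2 *\<^sub>R g2 P x"

definition g12 :: "ocp \<Rightarrow> real^3 \<Rightarrow> real^3" where
  "g12 P = bracket (g1 P) (g2 P)"

definition yd' :: "ocp \<Rightarrow> real \<Rightarrow> real^2" where
  "yd' P t = vector_derivative (yd P) (at t within {0..horizon P})"

definition yd'' :: "ocp \<Rightarrow> real \<Rightarrow> real^2" where
  "yd'' P t = vector_derivative (yd' P) (at t within {0..horizon P})"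

definition err :: "ocp \<Rightarrow> real \<Rightarrow> real^3 \<Rightarrow> real^2" where
  "err P t x = yd P t - phi P x"

definition err' :: "ocp \<Rightarrow> real \<Rightarrow> real^3 \<Rightarrow> real^2 \<Rightarrow> real^2" where
  "err' P t x u = yd' P t - u $ 1 *\<^sub>R lies (g1 P) (phi P) x"

definition running_cost :: "ocp \<Rightarrow> real \<Rightarrow> real^3 \<Rightarrow> real^2 \<Rightarrow> real" where
  "running_cost P t x u =
     (bil (Qrun P) (err P t x) (err P t x) + bil (Mrun P) (err' P t x u) (err' P t x u)) / 2"

definition cost :: "ocp \<Rightarrow> (real \<Rightarrow> real^3) \<Rightarrow> (real \<Rightarrow> real^2) \<Rightarrow> real" where
  "cost P x u = bil (Qbar P) (err P (horizon P) (x (horizon P))) (err P (horizon P) (x (horizon P))) / 2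
     + integral {0..horizon P} (\<lambda>t. running_cost P t (x t) (u t))"

text \<open>Caratheodory solutions staying in the coordinate domain \<open>U\<close>: the integral equation says that
  \<open>x\<close> is absolutely continuous with \<open>x(0) = x\<^sub>0\<close>, and the differential equation holds almost
  everywhere (the derivative being one-sided at the end points).\<close>

definition controlled_trajectory ::
  "ocp \<Rightarrow> (real^3) set \<Rightarrow> real^3 \<Rightarrow> (real \<Rightarrow> real^3) \<Rightarrow> (real \<Rightarrow> real^2) \<Rightarrow> bool" where
  "controlled_trajectory P U x0 x u \<longleftrightarrow>
     u \<in> borel_measurable (lebesgue_on {0..horizon P}) \<and>
     (\<forall>t\<in>{0..horizon P}. x t \<in> U) \<and>
     (\<lambda>t. sys P (x t) (u t)) absolutely_integrable_on {0..horizon P} \<and>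
     (\<forall>t\<in>{0..horizon P}. x t = x0 + integral {0..t} (\<lambda>s. sys P (x s) (u s))) \<and>
     (\<exists>Z. negligible Z \<and> (\<forall>t\<in>{0..horizon P} - Z.
        (x has_vector_derivative sys P (x t) (u t)) (at t within {0..horizon P})))"


section \<open>Necessary conditions\<close>

definition hamiltonian :: "ocp \<Rightarrow> real \<Rightarrow> real^3 \<Rightarrow> real^3 \<Rightarrow> real^2 \<Rightarrow> real" where
  "hamiltonian P t x p u = running_cost P t x u + p \<bullet> sys P x u"

definition costate_rhs :: "ocp \<Rightarrow> real \<Rightarrow> real^3 \<Rightarrow> real^3 \<Rightarrow> real^2 \<Rightarrow> real^3" where
  "costate_rhs P t x p u = (\<chi> k.
     bil (Qrun P) (err P t x) (pds k (phi P) x)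
     + bil (Mrun P) (err' P t x u) (pds k (lies (g1 P) (phi P)) x) * u $ 1
     - (p \<bullet> pds k (g1 P) x * u $ 1 + p \<bullet> pds k (g2 P) x * u $ 2))"

definition closed_costate :: "ocp \<Rightarrow> real \<Rightarrow> real^3 \<Rightarrow> real^3" where
  "closed_costate P t x = (\<chi> k. - bil (Qbar P) (err P t x) (pds k (phi P) x))"

definition xi1 :: "ocp \<Rightarrow> real \<Rightarrow> real^3 \<Rightarrow> real^3 \<Rightarrow> real^2 \<Rightarrow> real" where
  "xi1 P t x p u = pd 1 (hamiltonian P t x p) u"

definition xi2 :: "ocp \<Rightarrow> real \<Rightarrow> real^3 \<Rightarrow> real^3 \<Rightarrow> real^2 \<Rightarrow> real" where
  "xi2 P t x p u = pd 2 (hamiltonian P t x p) u"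

definition xi2_dot :: "ocp \<Rightarrow> real \<Rightarrow> real^3 \<Rightarrow> real^3 \<Rightarrow> real^2 \<Rightarrow> real" where
  "xi2_dot P t x p u =
     (- bil (Mrun P) (err' P t x u) (lies (g12 P) (phi P) x) + p \<bullet> g12 P x) * u $ 1"

text \<open>Total time derivative of a function \<open>\<psi>(t,x,p,u)\<close> that does not depend on \<open>u\<^sup>2\<close>, along the state
  and costate equations, with \<open>w\<close> in the role of the derivative of \<open>u\<^sup>1\<close>. The interval
  \<open>{-t..T-t}\<close> keeps time inside \<open>[0,T]\<close>, where the reference is defined.\<close>

definition total_deriv ::
  "ocp \<Rightarrow> (real \<Rightarrow> real^3 \<Rightarrow> real^3 \<Rightarrow> real^2 \<Rightarrow> real)
     \<Rightarrow> real \<Rightarrow> real^3 \<Rightarrow> real^3 \<Rightarrow> real^2 \<Rightarrow> real \<Rightarrow> real" where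
  "total_deriv P \<psi> t x p u w = vector_derivative
     (\<lambda>s. \<psi> (t + s) (x + s *\<^sub>R sys P x u) (p + s *\<^sub>R costate_rhs P t x p u) (u + s *\<^sub>R axis 1 w))
     (at 0 within {- t..horizon P - t})"

text \<open>On a singular arc \<open>\<xi>\<^sub>1 = 0\<close> persists; this determines the derivative of \<open>u\<^sup>1\<close>, since
  \<open>\<partial>\<xi>\<^sub>1/\<partial>u\<^sup>1 > 0\<close>. The second derivative of \<open>\<xi>\<^sub>2\<close> is taken with this value, so its dependence on
  \<open>u\<^sup>2\<close> in the generalized Legendre--Clebsch condition includes the one through the derivative of
  \<open>u\<^sup>1\<close>.\<close>

definition u1_dot :: "ocp \<Rightarrow> real \<Rightarrow> real^3 \<Rightarrow> real^3 \<Rightarrow> real^2 \<Rightarrow> real" where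
  "u1_dot P t x p u = (THE w. total_deriv P (xi1 P) t x p u w = 0)"

definition xi2_ddot :: "ocp \<Rightarrow> real \<Rightarrow> real^3 \<Rightarrow> real^3 \<Rightarrow> real^2 \<Rightarrow> real" where
  "xi2_ddot P t x p u = total_deriv P (xi2_dot P) t x p u (u1_dot P t x p u)"

definition singular_conditions :: "ocp \<Rightarrow> real \<Rightarrow> real^3 \<Rightarrow> real^3 \<Rightarrow> real^2 \<Rightarrow> bool" where
  "singular_conditions P t x p u \<longleftrightarrow>
     xi1 P t x p u = 0 \<and> xi2 P t x p u = 0 \<and> xi2_dot P t x p u = 0 \<and> xi2_ddot P t x p u = 0 \<and>
     pd 1 (pd 1 (hamiltonian P t x p)) u > 0 \<and>
     - pd 2 (xi2_ddot P t x p) u > 0"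

text \<open>\<open>p\<close> is the costate along \<open>x\<close>. The pointwise conditions are required at every time with both
  inputs in the interior of their bounds, hence on every singular arc of this kind. Otherwise the
  respective input is on its bound: \<open>u\<^sup>1\<close> if it is not stationary, \<open>u\<^sup>2\<close> off the singular manifold.\<close>

definition optimal_candidate ::
  "ocp \<Rightarrow> (real^3) set \<Rightarrow> real^3 \<Rightarrow> (real \<Rightarrow> real^3) \<Rightarrow> (real \<Rightarrow> real^3) \<Rightarrow> (real \<Rightarrow> real^2) \<Rightarrow> bool" where
  "optimal_candidate P U x0 x p u \<longleftrightarrow>
     controlled_trajectory P U x0 x u \<and>
     (\<forall>t\<in>{0..horizon P}. \<forall>a. \<bar>u t $ a\<bar> \<le> umax P $ a) \<and>
     p (horizon P) = (\<chi> k. - bil (Qbar P) (err P (horizon P) (x (horizon P)))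
                              (pds k (phi P) (x (horizon P)))) \<and>
     (\<exists>Z. negligible Z \<and> (\<forall>t\<in>{0..horizon P} - Z. (\<forall>a. \<bar>u t $ a\<bar> < umax P $ a) \<longrightarrow>
        (p has_vector_derivative costate_rhs P t (x t) (p t) (u t)) (at t within {0..horizon P}))) \<and>
     (\<forall>t\<in>{0..horizon P}.
        ((\<forall>a. \<bar>u t $ a\<bar> < umax P $ a) \<longrightarrow> singular_conditions P t (x t) (p t) (u t)) \<and>
        (xi1 P t (x t) (p t) (u t) \<noteq> 0 \<longrightarrow> \<bar>u t $ 1\<bar> = umax P $ 1) \<and>
        (xi2 P t (x t) (p t) (u t) \<noteq> 0 \<or> xi2_dot P t (x t) (p t) (u t) \<noteq> 0
           \<longrightarrow> \<bar>u t $ 2\<bar> = umax P $ 2))"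


section \<open>The control law\<close>

definition A11 :: "ocp \<Rightarrow> real^3 \<Rightarrow> real" where
  "A11 P x = bil (Mrun P) (lies (g1 P) (phi P) x) (lies (g1 P) (phi P) x)"

definition A12 :: "ocp \<Rightarrow> real^3 \<Rightarrow> real" where
  "A12 P x = bil (Mrun P) (lies (g12 P) (phi P) x) (lies (g1 P) (phi P) x)"

definition A21 :: "ocp \<Rightarrow> real^3 \<Rightarrow> real" where
  "A21 P x = bil (Mrun P) (lies (g1 P) (phi P) x) (lies (g12 P) (phi P) x)"

definition A22 :: "ocp \<Rightarrow> real^3 \<Rightarrow> real" where
  "A22 P x = bil (Mrun P) (lies (g12 P) (phi P) x) (lies (g12 P) (phi P) x)"

definition b_form :: "ocp \<Rightarrow> real \<Rightarrow> real^3 \<Rightarrow> real \<Rightarrow> real^2 \<Rightarrow> real" where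
  "b_form P t x u1 v =
     bil (Mrun P) (yd'' P t - u1\<^sup>2 *\<^sub>R lies (g1 P) (lies (g1 P) (phi P)) x) v - bil (Qrun P) (err P t x) v"

definition b1 :: "ocp \<Rightarrow> real \<Rightarrow> real^3 \<Rightarrow> real \<Rightarrow> real" where
  "b1 P t x u1 = b_form P t x u1 (lies (g1 P) (phi P) x)"

definition b2 :: "ocp \<Rightarrow> real \<Rightarrow> real^3 \<Rightarrow> real \<Rightarrow> real" where
  "b2 P t x u1 = b_form P t x u1 (lies (g12 P) (phi P) x)"

definition u1_sing :: "ocp \<Rightarrow> real \<Rightarrow> real^3 \<Rightarrow> real" where
  "u1_sing P t x =
     (bil (Mrun P) (yd' P t) (lies (g1 P) (phi P) x) + bil (Qbar P) (err P t x) (lies (g1 P) (phi P) x))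
     / A11 P x"

definition u2_sing :: "ocp \<Rightarrow> real \<Rightarrow> real^3 \<Rightarrow> real \<Rightarrow> real" where
  "u2_sing P t x u1 =
     (A11 P x * b2 P t x u1 - A21 P x * b1 P t x u1) / ((A12 P x * A21 P x - A11 P x * A22 P x) * u1)"

definition u1_law :: "ocp \<Rightarrow> real \<Rightarrow> real^3 \<Rightarrow> real" where
  "u1_law P t x =
     (if \<bar>u1_sing P t x\<bar> \<ge> umax P $ 1 then sgn (u1_sing P t x) * umax P $ 1 else u1_sing P t x)"

text \<open>Here \<open>\<xi>\<^sub>2\<close>-dot is evaluated with the closed-form costate and the applied input \<open>u\<^sup>1\<close>; it does not
  depend on \<open>u\<^sup>2\<close>, so the second input component is set to \<open>0\<close>.\<close>

definition xi2_dot_closed :: "ocp \<Rightarrow> real \<Rightarrow> real^3 \<Rightarrow> real \<Rightarrow> real" where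
  "xi2_dot_closed P t x u1 = xi2_dot P t x (closed_costate P t x) (axis 1 u1)"

definition u2_law :: "ocp \<Rightarrow> real \<Rightarrow> real^3 \<Rightarrow> real \<Rightarrow> real" where
  "u2_law P t x u1 =
     (if xi2_dot_closed P t x u1 \<noteq> 0 then sgn (xi2_dot_closed P t x u1) * umax P $ 2
      else if \<bar>u2_sing P t x u1\<bar> \<ge> umax P $ 2 then sgn (u2_sing P t x u1) * umax P $ 2
      else u2_sing P t x u1)"

end

theory Submission
  imports Defs
begin

text \<open>With the closed-form costate, \<open>\<xi>\<^sub>2 = - e Qbar L\<^sub>g\<^sub>2 \<phi>\<close> vanishes identically and
  \<open>\<xi>\<^sub>1 = A\<^sub>1\<^sub>1 (u\<^sup>1 - u\<^sup>1\<^sub>s\<^sub>i\<^sub>n\<^sub>g)\<close>. If both inputs are interior, then \<open>\<xi>\<^sub>1\<close> and \<open>\<xi>\<^sub>2\<close>-dot vanish, which says that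
  \<open>M e' + Qbar e\<close> is orthogonal to the linearly independent vectors \<open>L\<^sub>g\<^sub>1 \<phi>\<close> and \<open>L\<^sub>[\<^sub>g\<^sub>1\<^sub>,\<^sub>g\<^sub>2\<^sub>] \<phi>\<close>; so
  \<open>e' = - M\<^sup>-\<^sup>1 Qbar e\<close>. Together with \<open>Q = Qbar M\<^sup>-\<^sup>1 Qbar\<close>, this makes the closed-form costate satisfy the
  costate equation. Differentiating \<open>\<xi>\<^sub>1\<close> and \<open>\<xi>\<^sub>2\<close>-dot once more gives a linear system in
  \<open>(w, u\<^sup>2)\<close>, where \<open>w\<close> is the derivative of \<open>u\<^sup>1\<close>, whose determinant is the Gram determinant
  \<open>A\<^sub>1\<^sub>1 A\<^sub>2\<^sub>2 - A\<^sub>1\<^sub>2 A\<^sub>2\<^sub>1\<close> up to the factor \<open>- u\<^sup>1\<close>. Its solution is the singular law for \<open>u\<^sup>2\<close>, and positivity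
  of the determinant is the generalized Legendre--Clebsch condition.\<close>

section \<open>Symmetry of second derivatives\<close>

abbreviation D :: "('a::real_normed_vector \<Rightarrow> 'b::real_normed_vector) \<Rightarrow> 'a \<Rightarrow> 'a \<Rightarrow> 'b"
  where "D f x \<equiv> frechet_derivative f (at x)"

text \<open>Mean value inequality for the first difference in direction \<open>w\<close>, regarded
  as a function of the step in direction \<open>v\<close>. Its derivative compares
  \<open>D h _ v\<close> at two points that are \<open>s *\<^sub>R w\<close> apart, and
  differentiability of that map at \<open>x\<close> replaces the comparison by
  \<open>s *\<^sub>R A w\<close> up to a small error.\<close>

lemma second_difference_bound:
  fixes h :: "'a::real_normed_vector \<Rightarrow> 'b::real_normed_vector"
  assumes U: "open U" "x \<in> U" and h: "\<And>z. z \<in> U \<Longrightarrow> h differentiable at z"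
    and A: "((\<lambda>z. D h z v) has_derivative A) (at x)" and \<epsilon>: "0 < \<epsilon>"
  shows "\<exists>\<delta>>0. \<forall>s. 0 < s \<and> s < \<delta> \<longrightarrow>
    norm (h (x + s *\<^sub>R v + s *\<^sub>R w) - h (x + s *\<^sub>R v) - h (x + s *\<^sub>R w) + h x - s\<^sup>2 *\<^sub>R A w) \<le> \<epsilon> * s\<^sup>2"
proof -
  \<comment> \<open>Every point visited below lies within \<open>s * C\<close> of \<open>x\<close>.
    The summand 1 keeps \<open>C\<close> positive when \<open>v\<close> and \<open>w\<close> both
    vanish.\<close>
  define C where "C = norm v + norm w + 1"
  have C: "C > 0" by (simp add: C_def add_nonneg_pos)
  have linA: "linear A" using A has_derivative_linear by blast
  \<comment> \<open>The tolerance \<open>\<epsilon> / (2 * C)\<close> is spent at two points at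
    distance at most \<open>s * C\<close>, which adds up to \<open>\<epsilon> * s\<close>.\<close>
  obtain d where d: "d > 0" and dA:
    "\<And>y. norm (y - x) < d \<Longrightarrow> norm (D h y v - D h x v - A (y - x)) \<le> \<epsilon> / (2 * C) * norm (y - x)"
    using A C \<epsilon> unfolding has_derivative_at_alt by (metis mult_pos_pos zero_less_divide_iff zero_less_numeral)
  obtain r where r: "r > 0" "ball x r \<subseteq> U" using U openE by blast
  define \<delta> where "\<delta> = min d r / C"
  have "norm (h (x + s *\<^sub>R v + s *\<^sub>R w) - h (x + s *\<^sub>R v) - h (x + s *\<^sub>R w) + h x - s\<^sup>2 *\<^sub>R A w) \<le> \<epsilon> * s\<^sup>2"
    if s: "0 < s" "s < \<delta>" for s
  proof -
    have sC: "s * C < d" "s * C < r" using s C by (auto simp: \<delta>_def field_simps)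
    have small: "norm (\<rho> *\<^sub>R v + \<sigma> *\<^sub>R w) \<le> s * C" if "\<rho> \<in> {0..s}" "\<sigma> \<in> {0..s}" for \<rho> \<sigma>
    proof -
      have "norm (\<rho> *\<^sub>R v + \<sigma> *\<^sub>R w) \<le> \<rho> * norm v + \<sigma> * norm w"
        using that by (metis abs_of_nonneg atLeastAtMost_iff norm_scaleR norm_triangle_ineq)
      also have "\<dots> \<le> s * norm v + s * norm w"
        using that by (intro add_mono mult_right_mono) auto
      also have "\<dots> \<le> s * C" using s by (simp add: C_def algebra_simps)
      finally show ?thesis .
    qed
    \<comment> \<open>The expected linear part is already subtracted, so \<open>G s - G 0\<close> is
      exactly the quantity to be bounded.\<close>
    define G where "G \<rho> = h (x + \<rho> *\<^sub>R v + s *\<^sub>R w) - h (x + \<rho> *\<^sub>R v) - (\<rho> * s) *\<^sub>R A w" for \<rho>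
    define G' where "G' \<rho> = D h (x + \<rho> *\<^sub>R v + s *\<^sub>R w) v - D h (x + \<rho> *\<^sub>R v) v - s *\<^sub>R A w" for \<rho>
    have hd: "((\<lambda>\<rho>. h (y + \<rho> *\<^sub>R v)) has_vector_derivative D h (y + \<rho> *\<^sub>R v) v) (at \<rho> within S)"
      if "y + \<rho> *\<^sub>R v \<in> U" for y \<rho> S
    proof -
      have 1: "(h has_derivative D h (y + \<rho> *\<^sub>R v)) (at (y + \<rho> *\<^sub>R v))"
        using h[OF that] frechet_derivative_works by blast
      have 2: "((\<lambda>\<rho>. y + \<rho> *\<^sub>R v) has_derivative (\<lambda>t. t *\<^sub>R v)) (at \<rho> within S)"
        by (auto intro!: derivative_eq_intros)
      have "((\<lambda>\<rho>. h (y + \<rho> *\<^sub>R v)) has_derivative (\<lambda>t. D h (y + \<rho> *\<^sub>R v) (t *\<^sub>R v))) (at \<rho> within S)"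
        using has_derivative_compose[OF 2 1] .
      then show ?thesis
        by (simp add: has_vector_derivative_def linear_scale[OF has_derivative_linear[OF 1]])
    qed
    have near: "y \<in> U" if "norm (y - x) \<le> s * C" for y
      using that sC(2) by (intro subsetD[OF r(2)]) (simp add: dist_norm norm_minus_commute)
    have inU: "x + \<rho> *\<^sub>R v + s *\<^sub>R w \<in> U" "x + \<rho> *\<^sub>R v \<in> U" if "\<rho> \<in> {0..s}" for \<rho>
      using small[OF that, of s] small[OF that, of 0] s by (auto intro!: near simp: add.assoc simp del: norm_scaleR)
    have Gd: "(G has_derivative (\<lambda>t. t *\<^sub>R G' \<rho>)) (at \<rho> within {0..s})" if "\<rho> \<in> {0..s}" for \<rho>
    proof -
      have swap: "x + s *\<^sub>R w + \<rho> *\<^sub>R v = x + \<rho> *\<^sub>R v + s *\<^sub>R w" for \<rho> by (simp add: add.assoc add.commute)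
      have "((\<lambda>\<rho>. (\<rho> * s) *\<^sub>R A w) has_vector_derivative s *\<^sub>R A w) (at \<rho> within {0..s})"
        by (auto intro!: derivative_eq_intros simp: has_vector_derivative_def)
      moreover have "((\<lambda>\<rho>. h (x + \<rho> *\<^sub>R v + s *\<^sub>R w)) has_vector_derivative
          D h (x + \<rho> *\<^sub>R v + s *\<^sub>R w) v) (at \<rho> within {0..s})"
        using hd[of "x + s *\<^sub>R w" \<rho> "{0..s}"] inU(1)[OF that] unfolding swap by blast
      ultimately show ?thesis
        unfolding G_def G'_def has_vector_derivative_def[symmetric]
        by (intro has_vector_derivative_diff hd inU(2)[OF that])
    qed
    have G'b: "norm (G' \<rho>) \<le> \<epsilon> * s" if "\<rho> \<in> {0..s}" for \<rho>
    proof -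
      let ?y = "x + \<rho> *\<^sub>R v + s *\<^sub>R w" and ?z = "x + \<rho> *\<^sub>R v"
      have ny: "norm (?y - x) \<le> s * C" "norm (?z - x) \<le> s * C"
        using small[OF that, of s] small[OF that, of 0] s by (auto simp: add.assoc)
      have "A (?y - x) - A (?z - x) = s *\<^sub>R A w"
        using linA by (simp add: linear_diff linear_add linear_scale)
      then have "G' \<rho> = (D h ?y v - D h x v - A (?y - x)) - (D h ?z v - D h x v - A (?z - x))"
        by (simp add: G'_def algebra_simps)
      then have "norm (G' \<rho>) \<le> norm (D h ?y v - D h x v - A (?y - x)) + norm (D h ?z v - D h x v - A (?z - x))"
        by (metis norm_triangle_ineq4)
      also have "\<dots> \<le> \<epsilon> / (2 * C) * norm (?y - x) + \<epsilon> / (2 * C) * norm (?z - x)"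
        using ny sC by (intro add_mono dA) auto
      also have "\<dots> \<le> \<epsilon> / (2 * C) * (s * C) + \<epsilon> / (2 * C) * (s * C)"
        using ny C \<epsilon> by (intro add_mono mult_left_mono) auto
      also have "\<dots> = \<epsilon> * s" using C by (simp add: field_simps)
      finally show ?thesis .
    qed
    have "norm (G s - G 0) \<le> (\<epsilon> * s) * norm (s - 0)"
    proof (rule differentiable_bound[where S = "{0..s}" and f' = "\<lambda>\<rho> t. t *\<^sub>R G' \<rho>"])
      show "onorm (\<lambda>t. t *\<^sub>R G' \<rho>) \<le> \<epsilon> * s" if "\<rho> \<in> {0..s}" for \<rho>
        using G'b[OF that] by (intro onorm_le) (simp add: mult.commute mult_left_mono)
    qed (use Gd s in auto)
    moreover have "G s - G 0 =
        h (x + s *\<^sub>R v + s *\<^sub>R w) - h (x + s *\<^sub>R v) - h (x + s *\<^sub>R w) + h x - s\<^sup>2 *\<^sub>R A w"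
      by (simp add: G_def power2_eq_square)
    ultimately show ?thesis using s by (simp add: power2_eq_square mult.assoc)
  qed
  moreover have "\<delta> > 0" using d r C by (simp add: \<delta>_def)
  ultimately show ?thesis by blast
qed

text \<open>The second difference does not change when \<open>v\<close> and \<open>w\<close> are
  swapped, and divided by \<open>s\<^sup>2\<close> it is arbitrarily close both to
  \<open>A w\<close> and to \<open>B v\<close>.\<close>

lemma second_derivative_symmetric:
  fixes h :: "'a::real_normed_vector \<Rightarrow> 'b::real_normed_vector"
  assumes U: "open U" "x \<in> U" and h: "\<And>z. z \<in> U \<Longrightarrow> h differentiable at z"
    and A: "((\<lambda>z. D h z v) has_derivative A) (at x)"
    and B: "((\<lambda>z. D h z w) has_derivative B) (at x)"
  shows "A w = B v"
proof -
  have "norm (A w - B v) \<le> 2 * \<epsilon>" if \<epsilon>: "\<epsilon> > 0" for \<epsilon>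
  proof -
    let ?d = "\<lambda>s v w. h (x + s *\<^sub>R v + s *\<^sub>R w) - h (x + s *\<^sub>R v) - h (x + s *\<^sub>R w) + h x"
    obtain \<delta>1 \<delta>2 where \<delta>: "\<delta>1 > 0" "\<delta>2 > 0"
      and b1: "\<And>s. 0 < s \<Longrightarrow> s < \<delta>1 \<Longrightarrow> norm (?d s v w - s\<^sup>2 *\<^sub>R A w) \<le> \<epsilon> * s\<^sup>2"
      and b2: "\<And>s. 0 < s \<Longrightarrow> s < \<delta>2 \<Longrightarrow> norm (?d s w v - s\<^sup>2 *\<^sub>R B v) \<le> \<epsilon> * s\<^sup>2"
      using second_difference_bound[OF U h A \<epsilon>, of w] second_difference_bound[OF U h B \<epsilon>, of v] by metis
    define s where "s = min \<delta>1 \<delta>2 / 2"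
    have s: "0 < s" "s < \<delta>1" "s < \<delta>2" using \<delta> by (auto simp: s_def)
    have eq: "?d s w v = ?d s v w" by (simp add: algebra_simps)
    have "s\<^sup>2 *\<^sub>R (A w - B v) = (?d s w v - s\<^sup>2 *\<^sub>R B v) - (?d s v w - s\<^sup>2 *\<^sub>R A w)"
      unfolding eq by (simp add: algebra_simps)
    then have "norm (s\<^sup>2 *\<^sub>R (A w - B v)) \<le> \<epsilon> * s\<^sup>2 + \<epsilon> * s\<^sup>2"
      using b1[OF s(1,2)] b2[OF s(1,3)] by (smt (verit) norm_triangle_ineq4)
    then have "s\<^sup>2 * norm (A w - B v) \<le> s\<^sup>2 * (2 * \<epsilon>)" by (simp add: mult.commute mult.left_commute)
    then show ?thesis using s by simp
  qed
  then have "norm (A w - B v) \<le> 0 + \<epsilon>" if "\<epsilon> > 0" for \<epsilon>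
    using that[THEN half_gt_zero] by fastforce
  then have "norm (A w - B v) \<le> 0" by (rule field_le_epsilon)
  then show ?thesis by simp
qed

section \<open>Partial and Lie derivatives through the total derivative\<close>

text \<open>Second derivatives are tested one direction at a time, which is the form in which
  \<open>second_derivative_symmetric\<close> takes them.\<close>

definition C2_on :: "'a::real_normed_vector set \<Rightarrow> ('a \<Rightarrow> 'b::real_normed_vector) \<Rightarrow> bool" where
  "C2_on U f \<longleftrightarrow> open U \<and> (\<forall>x\<in>U. f differentiable at x \<and> (\<forall>v. (\<lambda>z. D f z v) differentiable at x))"

abbreviation D2 :: "('a::real_normed_vector \<Rightarrow> 'b::real_normed_vector) \<Rightarrow> 'a \<Rightarrow> 'a \<Rightarrow> 'a \<Rightarrow> 'b"
  where "D2 f x v \<equiv> D (\<lambda>z. D f z v) x"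

lemma smooth_on_imp_C2_on:
  assumes "open U" "smooth_on U f"
  shows "C2_on U f"
proof -
  have "Ck_on (Suc (Suc 0)) f U" using assms(2) unfolding smooth_on_def by blast
  then obtain f' where f': "\<And>x. x \<in> U \<Longrightarrow> (f has_derivative f' x) (at x within U)"
    and f'': "\<And>v. Ck_on (Suc 0) (\<lambda>x. f' x v) U"
    unfolding Ck_on.simps(2) by blast
  have d: "(f has_derivative f' x) (at x)" if "x \<in> U" for x
    using f'[OF that] unfolding at_within_open[OF that assms(1)] .
  have "(\<lambda>z. D f z v) differentiable at x" if x: "x \<in> U" for x v
  proof -
    obtain L where "((\<lambda>z. f' z v) has_derivative L) (at x within U)"
      using f''[of v] x by (auto simp: Ck_on.simps)
    then have "((\<lambda>z. f' z v) has_derivative L) (at x)"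
      unfolding at_within_open[OF x assms(1)] .
    \<comment> \<open>On the open set \<open>U\<close> the witness \<open>f'\<close> agrees with
      \<open>D f\<close> by uniqueness of derivatives, so its differentiability carries
      over.\<close>
    then have "((\<lambda>z. D f z v) has_derivative L) (at x)"
      by (rule has_derivative_transform_within_open[OF _ assms(1) x])
        (simp only: frechet_derivative_at[OF d, symmetric])
    then show ?thesis unfolding differentiable_def by blast
  qed
  then show ?thesis using d assms(1) unfolding C2_on_def differentiable_def by blast
qed

lemma C2_on_D: "C2_on U f \<Longrightarrow> x \<in> U \<Longrightarrow> (f has_derivative D f x) (at x)"
  unfolding C2_on_def using frechet_derivative_works by blast

lemma C2_on_D2: "C2_on U f \<Longrightarrow> x \<in> U \<Longrightarrow> ((\<lambda>z. D f z v) has_derivative D2 f x v) (at x)"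
  unfolding C2_on_def using frechet_derivative_works by blast

lemma linear_D: "C2_on U f \<Longrightarrow> x \<in> U \<Longrightarrow> linear (D f x)"
  using C2_on_D has_derivative_linear by blast

lemma linear_D2: "C2_on U f \<Longrightarrow> x \<in> U \<Longrightarrow> linear (D2 f x v)"
  using C2_on_D2 has_derivative_linear by blast

lemma D2_symmetric: "C2_on U f \<Longrightarrow> x \<in> U \<Longrightarrow> D2 f x v w = D2 f x w v"
  by (rule second_derivative_symmetric[where U = U and h = f])
    (auto intro: C2_on_D2 simp: C2_on_def)

lemma pd_eq:
  assumes "(h has_derivative h') (at x)"
  shows "pd k h x = h' (axis k 1)"
proof -
  have "((\<lambda>s. x + s *\<^sub>R axis k 1) has_derivative (\<lambda>t. t *\<^sub>R axis k 1)) (at 0)"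
    by (auto intro!: derivative_eq_intros)
  moreover have "(h has_derivative h') (at (x + 0 *\<^sub>R axis k 1))" using assms by simp
  ultimately have "((\<lambda>s. h (x + s *\<^sub>R axis k 1)) has_derivative (\<lambda>t. h' (t *\<^sub>R axis k 1))) (at 0)"
    by (rule has_derivative_compose)
  then have "((\<lambda>s. h (x + s *\<^sub>R axis k 1)) has_field_derivative h' (axis k 1)) (at 0)"
    by (simp add: has_field_derivative_def linear_scale[OF has_derivative_linear[OF assms]]
        mult_commute_abs)
  then show ?thesis unfolding pd_def by (rule DERIV_imp_deriv)
qed

lemma has_derivative_component:
  "(f has_derivative f') F \<Longrightarrow> ((\<lambda>z. f z $ j) has_derivative (\<lambda>v. f' v $ j)) F"
  by (rule bounded_linear.has_derivative[OF bounded_linear_vec_nth])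

lemma pds_eq: "(f has_derivative f') (at x) \<Longrightarrow> pds k f x = f' (axis k 1)"
  by (simp add: pds_def vec_eq_iff pd_eq[OF has_derivative_component])

lemma linear_basis_sum:
  fixes f :: "real^'n::finite \<Rightarrow> 'b::real_vector"
  assumes "linear f"
  shows "(\<Sum>k\<in>UNIV. v $ k *\<^sub>R f (axis k 1)) = f v"
  using linear_sum[OF assms, of "\<lambda>k. v $ k *\<^sub>R axis k 1" UNIV] basis_expansion[of v]
  by (simp add: linear_scale[OF assms] scalar_mult_eq_scaleR)

lemma lie_eq: "(h has_derivative h') (at x) \<Longrightarrow> lie g h x = h' (g x)"
  using linear_basis_sum[OF has_derivative_linear, of h h'] by (simp add: lie_def pd_eq)

lemma lies_eq: "(f has_derivative f') (at x) \<Longrightarrow> lies g f x = f' (g x)"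
  by (simp add: lies_def vec_eq_iff lie_eq[OF has_derivative_component])

lemma bracket_eq:
  assumes "(g has_derivative g') (at x)" "(h has_derivative h') (at x)"
  shows "bracket g h x = h' (g x) - g' (h x)"
  using lies_eq[OF assms(1), of h] lies_eq[OF assms(2), of g]
  by (simp add: bracket_def lies_def lie_def vec_eq_iff sum_subtractf)

text \<open>Product rule in the coordinate sum for \<open>lies g \<phi>\<close>. Linearity of
  \<open>D2\<close> is at hand in its last argument only, so symmetry first moves the basis vectors
  there, sums them to \<open>g x\<close>, and then moves \<open>g x\<close> back.\<close>

lemma lies_has_derivative:
  fixes \<phi> :: "real^'n::finite \<Rightarrow> real^'m::finite"
  assumes \<phi>: "C2_on U \<phi>" and x: "x \<in> U" and g: "(g has_derivative g') (at x)"
  shows "(lies g \<phi> has_derivative (\<lambda>w. D2 \<phi> x (g x) w + D \<phi> x (g' w))) (at x)"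
proof -
  have U: "open U" using \<phi> by (simp add: C2_on_def)
  have "((\<lambda>z. \<Sum>k\<in>UNIV. g z $ k *\<^sub>R D \<phi> z (axis k 1)) has_derivative
      (\<lambda>w. \<Sum>k\<in>UNIV. g x $ k *\<^sub>R D2 \<phi> x (axis k 1) w + g' w $ k *\<^sub>R D \<phi> x (axis k 1))) (at x)"
    by (intro has_derivative_sum has_derivative_scaleR has_derivative_component[OF g] C2_on_D2[OF \<phi> x])
  moreover have "(\<Sum>k\<in>UNIV. g x $ k *\<^sub>R D2 \<phi> x (axis k 1) w + g' w $ k *\<^sub>R D \<phi> x (axis k 1))
      = D2 \<phi> x (g x) w + D \<phi> x (g' w)" for w
    using linear_basis_sum[OF linear_D2[OF \<phi> x, of w], of "g x"]
      linear_basis_sum[OF linear_D[OF \<phi> x], of "g' w"]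
    by (simp add: sum.distrib D2_symmetric[OF \<phi> x, of w])
  moreover have "(\<Sum>k\<in>UNIV. g z $ k *\<^sub>R D \<phi> z (axis k 1)) = lies g \<phi> z" if "z \<in> U" for z
    using linear_basis_sum[OF linear_D[OF \<phi> that]] lies_eq[OF C2_on_D[OF \<phi> that]] by metis
  ultimately show ?thesis
    by (auto intro: has_derivative_transform_within_open[OF _ U x])
qed

section \<open>Derivatives along curves and on the time interval\<close>

lemma has_derivative_D: "(f has_derivative f') (at x) \<Longrightarrow> (f has_derivative D f x) (at x)"
  using frechet_derivative_works unfolding differentiable_def by blast

lemma has_vector_derivative_chain:
  assumes "(v has_derivative v') (at (c t))" "(c has_vector_derivative c') (at t within S)"
  shows "((\<lambda>s. v (c s)) has_vector_derivative v' c') (at t within S)"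
  using has_derivative_compose[OF assms(2)[unfolded has_vector_derivative_def] assms(1)]
  by (simp add: has_vector_derivative_def linear_scale[OF has_derivative_linear[OF assms(1)]])

lemma has_vector_derivative_shift:
  fixes f :: "real \<Rightarrow> 'a::real_normed_vector"
  assumes "(f has_vector_derivative f') (at t within {a..b})"
  shows "((\<lambda>s. f (t + s)) has_vector_derivative f') (at 0 within {a - t..b - t})"
proof -
  have "((\<lambda>s. t + s) has_derivative (\<lambda>s. s)) (at 0 within {a - t..b - t})"
    by (auto intro!: derivative_eq_intros)
  moreover have "(f has_derivative (\<lambda>s. s *\<^sub>R f')) (at (t + 0) within (\<lambda>s. t + s) ` {a - t..b - t})"
    using assms by (simp add: has_vector_derivative_def)
  ultimately show ?thesis
    unfolding has_vector_derivative_def by (rule has_derivative_in_compose)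
qed

lemma smooth_on_interval_vector_derivative:
  fixes y :: "real \<Rightarrow> 'a::euclidean_space"
  assumes y: "smooth_on {a..b} y" and ab: "a < b"
  defines "y' \<equiv> \<lambda>t. vector_derivative y (at t within {a..b})"
  defines "y'' \<equiv> \<lambda>t. vector_derivative y' (at t within {a..b})"
  assumes t: "t \<in> {a..b}"
  shows "(y has_vector_derivative y' t) (at t within {a..b})"
    and "(y' has_vector_derivative y'' t) (at t within {a..b})"
proof -
  have "Ck_on (Suc (Suc 0)) y {a..b}" using y unfolding smooth_on_def by blast
  then have "\<exists>F. (\<forall>t\<in>{a..b}. (y has_derivative F t) (at t within {a..b})) \<and>
      (\<forall>v. Ck_on (Suc 0) (\<lambda>t. F t v) {a..b})"
    by (rule Ck_on.simps(2)[THEN iffD1])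
  then obtain F where F: "\<And>t. t \<in> {a..b} \<Longrightarrow> (y has_derivative F t) (at t within {a..b})"
    and F1: "Ck_on (Suc 0) (\<lambda>t. F t 1) {a..b}"
    by blast
  have Fv: "(y has_vector_derivative F t 1) (at t within {a..b})" if "t \<in> {a..b}" for t
  proof -
    have "F t = (\<lambda>s. s *\<^sub>R F t 1)"
    proof
      show "F t s = s *\<^sub>R F t 1" for s
        using linear_scale[OF has_derivative_linear[OF F[OF that]], of s 1]
        unfolding real_scaleR_def mult_1_right .
    qed
    with F[OF that] show ?thesis unfolding has_vector_derivative_def by (rule back_subst)
  qed
  \<comment> \<open>One-sided derivatives on a nondegenerate interval are unique, so the chosen
    \<open>vector_derivative\<close> is the one supplied by smoothness.\<close>
  have y': "y' t = F t 1" if "t \<in> {a..b}" for t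
    unfolding y'_def by (rule vector_derivative_within_closed_interval[OF ab that Fv[OF that]])
  show "(y has_vector_derivative y' t) (at t within {a..b})" using Fv[OF t] y'[OF t] by simp
  obtain L where "((\<lambda>t. F t 1) has_derivative L) (at t within {a..b})"
    using F1[THEN Ck_on.simps(2)[THEN iffD1]] t by blast
  then have "(y' has_derivative L) (at t within {a..b})"
    by (rule has_derivative_transform[OF t, rotated]) (rule y')
  then have "y' differentiable at t within {a..b}" unfolding differentiable_def by blast
  then show "(y' has_vector_derivative y'' t) (at t within {a..b})"
    unfolding y''_def using vector_derivative_works by blast
qed

section \<open>The bilinear forms\<close>

lemma bounded_bilinear_bil: "bounded_bilinear (bil A)"
  unfolding bil_def
  by (rule bounded_bilinear.comp[OF bounded_bilinear_inner bounded_linear_ident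
        matrix_vector_mul_bounded_linear])

lemmas bil_simps =
  bounded_bilinear.add_left[OF bounded_bilinear_bil] bounded_bilinear.add_right[OF bounded_bilinear_bil]
  bounded_bilinear.diff_left[OF bounded_bilinear_bil] bounded_bilinear.diff_right[OF bounded_bilinear_bil]
  bounded_bilinear.minus_left[OF bounded_bilinear_bil] bounded_bilinear.minus_right[OF bounded_bilinear_bil]
  bounded_bilinear.scaleR_left[OF bounded_bilinear_bil] bounded_bilinear.scaleR_right[OF bounded_bilinear_bil]
  bounded_bilinear.zero_left[OF bounded_bilinear_bil] bounded_bilinear.zero_right[OF bounded_bilinear_bil]

lemma bil_eq_inner: "sym_pos_def A \<Longrightarrow> bil A v w = (A *v v) \<bullet> w"
  unfolding sym_pos_def_def bil_def by (metis dot_lmul_matrix transpose_matrix_vector)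

lemma bil_commute: "sym_pos_def A \<Longrightarrow> bil A v w = bil A w v"
  using bil_eq_inner[of A v w] by (simp add: bil_def inner_commute)

lemma sym_pos_def_invertible:
  assumes "sym_pos_def A"
  shows "invertible A"
proof -
  have "v = 0" if "A *v v = 0" for v
    using assms that unfolding sym_pos_def_def bil_def by (metis inner_zero_right less_irrefl)
  then have "inj ((*v) A)"
    using linear_injective_0[OF matrix_vector_mul_linear] by blast
  then show ?thesis
    unfolding invertible_left_inverse matrix_left_invertible_injective .
qed

text \<open>Subtracting from \<open>w\<close> its \<open>A\<close>-orthogonal projection onto
  \<open>v\<close> leaves a nonzero vector, whose positive \<open>A\<close>-square is the gap
  divided by \<open>bil A v v\<close>.\<close>

lemma bil_cauchy_schwarz_strict:
  assumes A: "sym_pos_def A" and v: "v \<noteq> 0" and w: "\<And>c. w \<noteq> c *\<^sub>R v"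
  shows "bil A w v * bil A v w < bil A v v * bil A w w"
proof -
  have vv: "bil A v v > 0" using A v by (simp add: sym_pos_def_def)
  let ?z = "w - (bil A v w / bil A v v) *\<^sub>R v"
  have "0 < bil A ?z ?z" using A w[of "bil A v w / bil A v v"] by (simp add: sym_pos_def_def)
  also have "bil A ?z ?z = bil A w w - bil A w v * bil A v w / bil A v v"
    using vv bil_commute[OF A, of v w] by (simp add: bil_simps field_simps)
  finally show ?thesis using vv by (simp add: field_simps)
qed

text \<open>Turns covectors given by their coordinates, such as the costate and its right-hand side,
  into linear functionals of a direction.\<close>

lemma vec_lambda_inner:
  fixes R :: "real^'n::finite \<Rightarrow> real"
  assumes "linear R"
  shows "(\<chi> k. R (axis k 1)) \<bullet> v = R v"
  using linear_basis_sum[OF assms, of v] by (simp add: inner_vec_def mult.commute)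

section \<open>The singular arc\<close>

text \<open>The setting of all pointwise arguments. The regularity of the flat output is kept as a
  scalar 2x2 determinant, ready for Cramer's rule.\<close>

locale flat_tracking =
  fixes P :: ocp and U :: "(real^3) set"
  assumes C2_g1: "C2_on U (g1 P)" and C2_g2: "C2_on U (g2 P)" and C2_phi: "C2_on U (phi P)"
    and lies_g2: "\<And>z. z \<in> U \<Longrightarrow> lies (g2 P) (phi P) z = 0"
    and det_nonzero: "\<And>z. z \<in> U \<Longrightarrow>
      lies (g1 P) (phi P) z $ 1 * lies (g12 P) (phi P) z $ 2
        - lies (g12 P) (phi P) z $ 1 * lies (g1 P) (phi P) z $ 2 \<noteq> 0"
    and horizon: "0 < horizon P" and yd: "smooth_on {0..horizon P} (yd P)"
    and Qbar: "sym_pos_def (Qbar P)" and Mrun: "sym_pos_def (Mrun P)"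
    and Qrun: "Qrun P = Qbar P ** matrix_inv (Mrun P) ** Qbar P"
begin

abbreviation "a \<equiv> lies (g1 P) (phi P)"
abbreviation "b \<equiv> lies (g12 P) (phi P)"

lemma U: "open U" using C2_phi by (simp add: C2_on_def)

section \<open>Derivatives of the Hamiltonian in the control\<close>

lemma err'_cong: "u $ 1 = u' $ 1 \<Longrightarrow> err' P t x u = err' P t x u'"
  by (simp add: err'_def)

lemma err'_derivative: "((\<lambda>u. err' P t x u) has_derivative (\<lambda>v. - (v $ 1) *\<^sub>R a x)) (at u)"
  unfolding err'_def by (auto intro!: derivative_eq_intros has_derivative_component)

text \<open>The running cost depends on \<open>u\<close> only through \<open>err'\<close>, hence
  only on \<open>u $ 1\<close>. Symmetry of \<open>Mrun P\<close> merges the two product-rule terms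
  and cancels the factor 1/2.\<close>

lemma hamiltonian_derivative:
  "(hamiltonian P t x p has_derivative
     (\<lambda>v. v $ 1 * (- bil (Mrun P) (err' P t x u) (a x) + p \<bullet> g1 P x) + v $ 2 * (p \<bullet> g2 P x))) (at u)"
proof -
  have "((\<lambda>u. p \<bullet> sys P x u) has_derivative (\<lambda>v. v $ 1 * (p \<bullet> g1 P x) + v $ 2 * (p \<bullet> g2 P x))) (at u)"
    unfolding sys_def inner_add_right inner_scaleR_right
    by (auto intro!: derivative_eq_intros has_derivative_component)
  moreover have "((\<lambda>u. running_cost P t x u) has_derivative
     (\<lambda>v. - (v $ 1) * bil (Mrun P) (err' P t x u) (a x))) (at u)"
  proof -
    have "((\<lambda>u. running_cost P t x u) has_derivative
      (\<lambda>v. (0 + (bil (Mrun P) (err' P t x u) (- (v $ 1) *\<^sub>R a x)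
        + bil (Mrun P) (- (v $ 1) *\<^sub>R a x) (err' P t x u))) / 2)) (at u)"
      unfolding running_cost_def
      by (intro bounded_linear.has_derivative[OF bounded_linear_divide] has_derivative_add
          has_derivative_const bounded_bilinear.FDERIV[OF bounded_bilinear_bil err'_derivative err'_derivative])
    moreover have "(0 + (bil (Mrun P) (err' P t x u) (- (v $ 1) *\<^sub>R a x)
        + bil (Mrun P) (- (v $ 1) *\<^sub>R a x) (err' P t x u))) / 2
      = - (v $ 1) * bil (Mrun P) (err' P t x u) (a x)" for v :: "real^2"
      unfolding bil_simps bil_commute[OF Mrun, of "a x"] by simp
    ultimately show ?thesis by simp
  qed
  ultimately have "(hamiltonian P t x p has_derivative
     (\<lambda>v. - (v $ 1) * bil (Mrun P) (err' P t x u) (a x) + (v $ 1 * (p \<bullet> g1 P x) + v $ 2 * (p \<bullet> g2 P x)))) (at u)"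
    unfolding hamiltonian_def[abs_def] by (intro has_derivative_add)
  then show ?thesis by (simp add: algebra_simps)
qed

lemma xi1_eq: "xi1 P t x p u = - bil (Mrun P) (err' P t x u) (a x) + p \<bullet> g1 P x"
  by (simp add: xi1_def pd_eq[OF hamiltonian_derivative] axis_def)

lemma xi2_eq: "xi2 P t x p u = p \<bullet> g2 P x"
  by (simp add: xi2_def pd_eq[OF hamiltonian_derivative] axis_def)

lemma hamiltonian_uu: "pd 1 (pd 1 (hamiltonian P t x p)) u = A11 P x"
proof -
  have "((\<lambda>u. - bil (Mrun P) (err' P t x u) (a x) + p \<bullet> g1 P x) has_derivative
      (\<lambda>v. v $ 1 * A11 P x)) (at u)"
    by (rule derivative_eq_intros bounded_bilinear.FDERIV[OF bounded_bilinear_bil err'_derivative] refl)+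
      (simp add: fun_eq_iff bil_simps A11_def)
  then have "(pd 1 (hamiltonian P t x p) has_derivative (\<lambda>v. v $ 1 * A11 P x)) (at u)"
    using xi1_eq unfolding xi1_def by presburger
  then show ?thesis by (simp add: pd_eq axis_def)
qed

lemma closed_costate_inner:
  assumes "x \<in> U"
  shows "closed_costate P t x \<bullet> v = - bil (Qbar P) (err P t x) (D (phi P) x v)"
proof -
  have "linear (\<lambda>v. - bil (Qbar P) (err P t x) (D (phi P) x v))"
    by (rule linearI) (simp_all add: bil_simps linear_add[OF linear_D[OF C2_phi assms]]
        linear_scale[OF linear_D[OF C2_phi assms]])
  from vec_lambda_inner[OF this] show ?thesis
    by (simp add: closed_costate_def pds_eq[OF C2_on_D[OF C2_phi assms]])
qed

section \<open>Lie derivatives of the flat output along the control fields\<close>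

lemma a_derivative:
  "x \<in> U \<Longrightarrow> (a has_derivative (\<lambda>w. D2 (phi P) x (g1 P x) w + D (phi P) x (D (g1 P) x w))) (at x)"
  by (rule lies_has_derivative[OF C2_phi _ C2_on_D[OF C2_g1]])

lemma D_a: "x \<in> U \<Longrightarrow> D a x w = D2 (phi P) x (g1 P x) w + D (phi P) x (D (g1 P) x w)"
  by (simp only: frechet_derivative_at[OF a_derivative, symmetric])

lemma a_derivative': "x \<in> U \<Longrightarrow> (a has_derivative D a x) (at x)"
  by (rule has_derivative_D[OF a_derivative])

text \<open>Differentiate the identity \<open>lies (g2 P) (phi P) z = 0\<close>, which holds
  throughout the open set \<open>U\<close>.\<close>

lemma D2_g2:
  assumes "x \<in> U"
  shows "D2 (phi P) x (g2 P x) w = - D (phi P) x (D (g2 P) x w)"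
proof -
  have "(lies (g2 P) (phi P) has_derivative (\<lambda>w. 0)) (at x)"
    by (rule has_derivative_transform_within_open[OF has_derivative_const U assms]) (simp add: lies_g2)
  from fun_cong[OF has_derivative_unique[OF this lies_has_derivative[OF C2_phi assms C2_on_D[OF C2_g2 assms]]], of w]
  show ?thesis by (simp only: eq_neg_iff_add_eq_0)
qed

lemma g12_eq: "x \<in> U \<Longrightarrow> g12 P x = D (g2 P) x (g1 P x) - D (g1 P) x (g2 P x)"
  unfolding g12_def by (rule bracket_eq[OF C2_on_D[OF C2_g1] C2_on_D[OF C2_g2]])

lemma g12_derivative:
  assumes "x \<in> U"
  shows "(g12 P has_derivative D (g12 P) x) (at x)"
proof -
  \<comment> \<open>The bracket is a difference of two componentwise Lie derivatives, each
    differentiable by \<open>lies_has_derivative\<close>.\<close>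
  have "((\<lambda>z. lies (g1 P) (g2 P) z - lies (g2 P) (g1 P) z) has_derivative
     (\<lambda>w. (D2 (g2 P) x (g1 P x) w + D (g2 P) x (D (g1 P) x w))
        - (D2 (g1 P) x (g2 P x) w + D (g1 P) x (D (g2 P) x w)))) (at x)" (is "(_ has_derivative ?L) _")
    by (rule has_derivative_diff[OF lies_has_derivative[OF C2_g2 assms C2_on_D[OF C2_g1 assms]]
          lies_has_derivative[OF C2_g1 assms C2_on_D[OF C2_g2 assms]]])
  then have "(g12 P has_derivative ?L) (at x)"
    by (rule has_derivative_transform_within_open[OF _ U assms])
      (simp add: g12_eq lies_eq[OF C2_on_D[OF C2_g1]] lies_eq[OF C2_on_D[OF C2_g2]])
  then show ?thesis by (rule has_derivative_D)
qed

text \<open>The commutator identity for \<open>g1 P\<close> and \<open>g2 P\<close> acting on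
  \<open>phi P\<close>, where the term containing \<open>lies (g2 P) (phi P)\<close> drops out.
  Through it \<open>u $ 2\<close> enters the second derivative of the error.\<close>

lemma D_a_g2:
  assumes "x \<in> U"
  shows "D a x (g2 P x) = - b x"
proof -
  have "D a x (g2 P x) = D2 (phi P) x (g2 P x) (g1 P x) + D (phi P) x (D (g1 P) x (g2 P x))"
    unfolding D_a[OF assms] by (subst D2_symmetric[OF C2_phi assms]) (rule refl)
  also have "\<dots> = - D (phi P) x (g12 P x)"
    unfolding D2_g2[OF assms] g12_eq[OF assms] linear_diff[OF linear_D[OF C2_phi assms]] by simp
  also have "\<dots> = - b x" unfolding lies_eq[OF C2_on_D[OF C2_phi assms]] ..
  finally show ?thesis .
qed

lemma D_a_sys:
  assumes "x \<in> U"
  shows "D a x (sys P x u) = u $ 1 *\<^sub>R lies (g1 P) a x - u $ 2 *\<^sub>R b x"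
proof -
  have "linear (D a x)" using a_derivative'[OF assms] has_derivative_linear by blast
  then show ?thesis
    unfolding sys_def lies_eq[OF a_derivative'[OF assms], of "g1 P"]
    by (simp add: linear_add linear_scale D_a_g2[OF assms])
qed

lemma costate_rhs_inner:
  assumes "x \<in> U"
  shows "costate_rhs P t x p u \<bullet> v =
    bil (Qrun P) (err P t x) (D (phi P) x v) + bil (Mrun P) (err' P t x u) (D a x v) * u $ 1
     - (p \<bullet> D (g1 P) x v * u $ 1 + p \<bullet> D (g2 P) x v * u $ 2)" (is "_ = ?R v")
proof -
  have "linear ?R"
    using linear_D[OF C2_phi assms] linear_D[OF C2_g1 assms] linear_D[OF C2_g2 assms]
      has_derivative_linear[OF a_derivative'[OF assms]]
    by (intro linearI) (simp_all only: linear_add linear_scale bil_simps inner_add_right inner_scaleR_right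
        real_scaleR_def algebra_simps)
  from vec_lambda_inner[OF this] show ?thesis
    by (simp add: costate_rhs_def pds_eq[OF C2_on_D[OF C2_phi assms]] pds_eq[OF C2_on_D[OF C2_g1 assms]]
        pds_eq[OF C2_on_D[OF C2_g2 assms]] pds_eq[OF a_derivative'[OF assms]])
qed

lemma yd_derivative:
  assumes "t \<in> {0..horizon P}"
  shows "(yd P has_vector_derivative yd' P t) (at t within {0..horizon P})"
    and "(yd' P has_vector_derivative yd'' P t) (at t within {0..horizon P})"
  using smooth_on_interval_vector_derivative[OF yd horizon assms]
  unfolding yd'_def[abs_def] yd''_def[abs_def] .

lemma a_nonzero: "x \<in> U \<Longrightarrow> a x \<noteq> 0"
  using det_nonzero[of x] by auto

lemma A11_pos: "x \<in> U \<Longrightarrow> A11 P x > 0"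
  using a_nonzero Mrun by (simp add: A11_def sym_pos_def_def)

text \<open>A Gram determinant in the metric \<open>Mrun P\<close>. If \<open>b x\<close> were a
  multiple of \<open>a x\<close>, the determinant in \<open>det_nonzero\<close> would
  vanish.\<close>

lemma A_det_pos: "x \<in> U \<Longrightarrow> A12 P x * A21 P x < A11 P x * A22 P x"
proof -
  assume x: "x \<in> U"
  have "b x \<noteq> c *\<^sub>R a x" for c
    using det_nonzero[OF x] by auto
  then show ?thesis
    unfolding A11_def A12_def A21_def A22_def
    by (intro bil_cauchy_schwarz_strict Mrun a_nonzero[OF x])
qed

section \<open>Stationary points and the costate equation\<close>

text \<open>The first-order error dynamics \<open>e' = - M\<^sup>-\<^sup>1 Qbar e\<close>, written
  without the inverse so that it can be paired with any vector. It involves the control only through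
  \<open>u $ 1\<close>.\<close>

definition stationary :: "real \<Rightarrow> real^3 \<Rightarrow> real^2 \<Rightarrow> bool" where
  "stationary t x u \<longleftrightarrow> Mrun P *v err' P t x u + Qbar P *v err P t x = 0"

lemma stationary_cong: "u $ 1 = u' $ 1 \<Longrightarrow> stationary t x u = stationary t x u'"
  unfolding stationary_def using err'_cong by metis

lemma stationary_Qbar:
  assumes "stationary t x u"
  shows "bil (Qbar P) (err P t x) w = - bil (Mrun P) (err' P t x u) w"
proof -
  have "Qbar P *v err P t x = - (Mrun P *v err' P t x u)"
    using assms unfolding stationary_def by (metis add.commute eq_neg_iff_add_eq_0)
  then show ?thesis by (simp add: bil_eq_inner[OF Qbar] bil_eq_inner[OF Mrun])
qed

text \<open>Stationarity is tested against \<open>?z\<close>, the image of \<open>w\<close> under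
  \<open>M\<^sup>-\<^sup>1 Qbar\<close>: the product form of \<open>Qrun P\<close> brings in
  \<open>?z\<close>, and \<open>Mrun P\<close> then cancels the inverse.\<close>

lemma stationary_Qrun:
  assumes "stationary t x u"
  shows "bil (Qrun P) (err P t x) w = - bil (Qbar P) (err' P t x u) w"
proof -
  let ?z = "matrix_inv (Mrun P) *v (Qbar P *v w)"
  have "bil (Qrun P) (err P t x) w = bil (Qbar P) (err P t x) ?z"
    by (simp add: bil_def Qrun matrix_vector_mul_assoc matrix_mul_assoc)
  also have "\<dots> = - bil (Mrun P) (err' P t x u) ?z" by (rule stationary_Qbar[OF assms])
  \<comment> \<open>\<open>matrix_inv\<close> is a choice; invertibility of the positive definite
    \<open>Mrun P\<close> makes the chosen matrix a true inverse.\<close>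
  also have "Mrun P *v ?z = Qbar P *v w"
    using someI_ex[OF sym_pos_def_invertible[OF Mrun, unfolded invertible_def]]
    unfolding matrix_inv_def[symmetric] by (simp add: matrix_vector_mul_assoc matrix_mul_assoc)
  then have "bil (Mrun P) (err' P t x u) ?z = bil (Qbar P) (err' P t x u) w" by (simp add: bil_def)
  finally show ?thesis .
qed

lemma stationaryI:
  assumes x: "x \<in> U"
    and a: "bil (Qbar P) (err P t x) (a x) = - bil (Mrun P) (err' P t x u) (a x)"
    and b: "bil (Qbar P) (err P t x) (b x) = - bil (Mrun P) (err' P t x u) (b x)"
  shows "stationary t x u"
proof -
  let ?z = "Mrun P *v err' P t x u + Qbar P *v err P t x"
  have za: "?z \<bullet> a x = 0" and zb: "?z \<bullet> b x = 0"
    using a b by (simp_all add: bil_eq_inner[OF Qbar] bil_eq_inner[OF Mrun] inner_add_left)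
  let ?d = "a x $ 1 * b x $ 2 - b x $ 1 * a x $ 2"
  \<comment> \<open>Cramer's rule: both components of \<open>?z\<close> are recovered from its
    pairings with \<open>a x\<close> and \<open>b x\<close>.\<close>
  have "?z $ 1 * ?d = (?z \<bullet> a x) * b x $ 2 - (?z \<bullet> b x) * a x $ 2"
    and "?z $ 2 * ?d = (?z \<bullet> b x) * a x $ 1 - (?z \<bullet> a x) * b x $ 1"
    unfolding inner_vec_def sum_2 inner_real_def by algebra+
  then have "?z $ 1 = 0" "?z $ 2 = 0"
    unfolding za zb using det_nonzero[OF x] by simp_all
  then show ?thesis unfolding stationary_def vec_eq_iff forall_2 by simp
qed

lemma closed_costate_stationary:
  "x \<in> U \<Longrightarrow> stationary t x u \<Longrightarrow>
    closed_costate P t x \<bullet> v = bil (Mrun P) (err' P t x u) (D (phi P) x v)"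
  by (simp add: closed_costate_inner stationary_Qbar)

text \<open>The terms with the derivative of \<open>g1 P\<close> cancel against the part of
  \<open>D a x v\<close> that comes from moving the field. Those with the derivative of
  \<open>g2 P\<close> become second derivatives of \<open>phi P\<close> by \<open>D2_g2\<close>.
  What remains assembles to \<open>D2\<close> in the direction \<open>sys P x u\<close>.\<close>

lemma costate_rhs_stationary:
  assumes x: "x \<in> U" and st: "stationary t x u"
  shows "costate_rhs P t x (closed_costate P t x) u \<bullet> v =
    - bil (Qbar P) (err' P t x u) (D (phi P) x v) + bil (Mrun P) (err' P t x u) (D2 (phi P) x v (sys P x u))"
proof -
  have D2: "D2 (phi P) x v (sys P x u) = u $ 1 *\<^sub>R D2 (phi P) x (g1 P x) v + u $ 2 *\<^sub>R D2 (phi P) x (g2 P x) v"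
    unfolding sys_def linear_add[OF linear_D2[OF C2_phi x]] linear_scale[OF linear_D2[OF C2_phi x]]
    unfolding D2_symmetric[OF C2_phi x, of v] ..
  show ?thesis
    unfolding costate_rhs_inner[OF x] stationary_Qrun[OF st] closed_costate_stationary[OF x st]
      D_a[OF x] D2 D2_g2[OF x]
    by (simp add: bil_simps algebra_simps)
qed

lemma D_phi_sys:
  assumes "x \<in> U"
  shows "D (phi P) x (sys P x u) = u $ 1 *\<^sub>R a x"
  using lies_g2[OF assms]
  unfolding sys_def linear_add[OF linear_D[OF C2_phi assms]] linear_scale[OF linear_D[OF C2_phi assms]]
    lies_eq[OF C2_on_D[OF C2_phi assms]] by simp

text \<open>The closed formula is differentiated by the product rule for arbitrary motion, and
  stationarity is invoked only at the instant \<open>t\<close>. Hence the times with interior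
  controls need not form an interval.\<close>

lemma costate_equation:
  assumes U: "\<And>\<tau>. \<tau> \<in> {0..horizon P} \<Longrightarrow> x \<tau> \<in> U" and t: "t \<in> {0..horizon P}"
    and x: "(x has_vector_derivative sys P (x t) u) (at t within {0..horizon P})"
    and st: "stationary t (x t) u"
  shows "((\<lambda>\<tau>. closed_costate P \<tau> (x \<tau>)) has_vector_derivative
    costate_rhs P t (x t) (closed_costate P t (x t)) u) (at t within {0..horizon P})"
  unfolding has_vector_derivative_def has_derivative_componentwise_within[of "\<lambda>\<tau>. closed_costate P \<tau> (x \<tau>)"]
proof
  fix i :: "real^3"
  have e: "((\<lambda>\<tau>. err P \<tau> (x \<tau>)) has_vector_derivative err' P t (x t) u) (at t within {0..horizon P})"
    using has_vector_derivative_diff[OF yd_derivative(1)[OF t]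
        has_vector_derivative_chain[OF C2_on_D[OF C2_phi U[OF t]] x]]
    unfolding err_def err'_def D_phi_sys[OF U[OF t]] .
  have "((\<lambda>\<tau>. - bil (Qbar P) (err P \<tau> (x \<tau>)) (D (phi P) (x \<tau>) i)) has_vector_derivative
      - (bil (Qbar P) (err P t (x t)) (D2 (phi P) (x t) i (sys P (x t) u))
        + bil (Qbar P) (err' P t (x t) u) (D (phi P) (x t) i))) (at t within {0..horizon P})"
    by (intro has_vector_derivative_minus bounded_bilinear.has_vector_derivative[OF bounded_bilinear_bil e
          has_vector_derivative_chain[OF C2_on_D2[OF C2_phi U[OF t]] x]])
  then have "((\<lambda>\<tau>. closed_costate P \<tau> (x \<tau>) \<bullet> i) has_derivative
      (\<lambda>h. h *\<^sub>R - (bil (Qbar P) (err P t (x t)) (D2 (phi P) (x t) i (sys P (x t) u))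
        + bil (Qbar P) (err' P t (x t) u) (D (phi P) (x t) i)))) (at t within {0..horizon P})"
    unfolding has_vector_derivative_def
    by (rule has_derivative_transform[OF t, rotated]) (simp add: closed_costate_inner[OF U])
  moreover have "- (bil (Qbar P) (err P t (x t)) (D2 (phi P) (x t) i (sys P (x t) u))
        + bil (Qbar P) (err' P t (x t) u) (D (phi P) (x t) i))
     = costate_rhs P t (x t) (closed_costate P t (x t)) u \<bullet> i"
    unfolding costate_rhs_stationary[OF U[OF t] st] stationary_Qbar[OF st] by simp
  ultimately show "((\<lambda>\<tau>. closed_costate P \<tau> (x \<tau>) \<bullet> i) has_derivative
      (\<lambda>h. (h *\<^sub>R costate_rhs P t (x t) (closed_costate P t (x t)) u) \<bullet> i)) (at t within {0..horizon P})"
    by simp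
qed

text \<open>Differentiating \<open>\<lambda>\<cdot>v\<close> along the costate equation is the same as differentiating
  \<open>- e Qbar L\<^sub>v \<phi>\<close>, so no bracket of \<open>v\<close> with the control fields enters.\<close>

lemma pairing_derivative:
  assumes t: "t \<in> {0..horizon P}" and x: "x \<in> U" and st: "stationary t x u"
    and v: "(v has_derivative v') (at x)"
  shows "((\<lambda>s. - bil (Mrun P) (err' P (t + s) (x + s *\<^sub>R sys P x u) (u + s *\<^sub>R axis 1 w))
              (lies v (phi P) (x + s *\<^sub>R sys P x u))
            + (closed_costate P t x + s *\<^sub>R costate_rhs P t x (closed_costate P t x) u)
              \<bullet> v (x + s *\<^sub>R sys P x u))
      has_vector_derivative
        - b_form P t x (u $ 1) (lies v (phi P) x) + w * bil (Mrun P) (a x) (lies v (phi P) x)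
        - u $ 1 * u $ 2 * bil (Mrun P) (b x) (lies v (phi P) x)) (at 0 within {- t..horizon P - t})"
proof -
  let ?S = "{- t..horizon P - t}" and ?f = "sys P x u" and ?c = "lies v (phi P)"
  let ?r = "costate_rhs P t x (closed_costate P t x) u" and ?p = "closed_costate P t x"
  have curve: "((\<lambda>s. x + s *\<^sub>R ?f) has_vector_derivative ?f) (at 0 within ?S)"
    by (auto intro!: derivative_eq_intros simp: has_vector_derivative_def)
  have along: "((\<lambda>s. h (x + s *\<^sub>R ?f)) has_vector_derivative h' ?f) (at 0 within ?S)"
    if "(h has_derivative h') (at x)" for h :: "real^3 \<Rightarrow> real^'k::finite" and h'
    using has_vector_derivative_chain[OF _ curve, of h h'] that by simp
  have y: "((\<lambda>s. yd' P (t + s)) has_vector_derivative yd'' P t) (at 0 within ?S)"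
    using has_vector_derivative_shift[OF yd_derivative(2)[OF t]] by simp
  have u1: "((\<lambda>s. u $ 1 + s * w) has_real_derivative w) (at 0 within ?S)"
    by (auto intro!: derivative_eq_intros)
  have e: "((\<lambda>s. err' P (t + s) (x + s *\<^sub>R ?f) (u + s *\<^sub>R axis 1 w)) has_vector_derivative
      yd'' P t - (u $ 1 *\<^sub>R D a x ?f + w *\<^sub>R a x)) (at 0 within ?S)"
    using has_vector_derivative_diff[OF y has_vector_derivative_scaleR[OF u1 along[OF a_derivative'[OF x]]]]
    by (simp add: err'_def axis_def)
  have p: "((\<lambda>s. ?p + s *\<^sub>R ?r) has_vector_derivative ?r) (at 0 within ?S)"
    by (auto intro!: derivative_eq_intros simp: has_vector_derivative_def)
  have *: "((\<lambda>s. - bil (Mrun P) (err' P (t + s) (x + s *\<^sub>R ?f) (u + s *\<^sub>R axis 1 w)) (?c (x + s *\<^sub>R ?f))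
            + (?p + s *\<^sub>R ?r) \<bullet> v (x + s *\<^sub>R ?f)) has_vector_derivative
      - (bil (Mrun P) (err' P (t + 0) (x + 0 *\<^sub>R ?f) (u + 0 *\<^sub>R axis 1 w))
            (D2 (phi P) x (v x) ?f + D (phi P) x (v' ?f))
          + bil (Mrun P) (yd'' P t - (u $ 1 *\<^sub>R D a x ?f + w *\<^sub>R a x)) (?c (x + 0 *\<^sub>R ?f)))
      + ((?p + 0 *\<^sub>R ?r) \<bullet> v' ?f + ?r \<bullet> v (x + 0 *\<^sub>R ?f))) (at 0 within ?S)"
    by (intro has_vector_derivative_add has_vector_derivative_minus
        bounded_bilinear.has_vector_derivative[OF bounded_bilinear_bil e
          along[OF lies_has_derivative[OF C2_phi x v]]]
        bounded_bilinear.has_vector_derivative[OF bounded_bilinear_inner p along[OF v]])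
  \<comment> \<open>The running-cost term of \<open>b_form\<close> is what the costate derivative
    contributes.\<close>
  have Q: "bil (Qrun P) (err P t x) (?c x) = - bil (Qbar P) (err' P t x u) (D (phi P) x (v x))"
    unfolding stationary_Qrun[OF st] lies_eq[OF C2_on_D[OF C2_phi x]] ..
  \<comment> \<open>The terms with \<open>v' ?f\<close> cancel because the closed costate pairs like
    \<open>M e'\<close>, and the \<open>D2\<close> terms cancel by
    \<open>costate_rhs_stationary\<close>. The summand with \<open>u $ 1 * u $ 2\<close> stems from
    \<open>D_a_sys\<close>.\<close>
  have eq: "- (bil (Mrun P) (err' P (t + 0) (x + 0 *\<^sub>R ?f) (u + 0 *\<^sub>R axis 1 w))
            (D2 (phi P) x (v x) ?f + D (phi P) x (v' ?f))
          + bil (Mrun P) (yd'' P t - (u $ 1 *\<^sub>R D a x ?f + w *\<^sub>R a x)) (?c (x + 0 *\<^sub>R ?f)))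
      + ((?p + 0 *\<^sub>R ?r) \<bullet> v' ?f + ?r \<bullet> v (x + 0 *\<^sub>R ?f))
    = - b_form P t x (u $ 1) (?c x) + w * bil (Mrun P) (a x) (?c x) - u $ 1 * u $ 2 * bil (Mrun P) (b x) (?c x)"
    unfolding b_form_def Q D_a_sys[OF x] scaleR_zero_left add_0_right
      closed_costate_stationary[OF x st] costate_rhs_stationary[OF x st]
    by (simp add: bil_simps algebra_simps power2_eq_square)
  show ?thesis using * unfolding eq .
qed

section \<open>Time derivatives of the switching functions\<close>

lemma total_deriv_eq:
  assumes t: "t \<in> {0..horizon P}"
    and d: "((\<lambda>s. \<psi> (t + s) (x + s *\<^sub>R sys P x u) (p + s *\<^sub>R costate_rhs P t x p u) (u + s *\<^sub>R axis 1 w))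
      has_vector_derivative d) (at 0 within {- t..horizon P - t})"
  shows "total_deriv P \<psi> t x p u w = d"
  unfolding total_deriv_def
  by (rule vector_derivative_within_closed_interval[OF _ _ d]) (use t horizon in auto)

lemma total_deriv_xi1:
  assumes "t \<in> {0..horizon P}" "x \<in> U" "stationary t x u"
  shows "total_deriv P (xi1 P) t x (closed_costate P t x) u w
    = - b1 P t x (u $ 1) + w * A11 P x - u $ 1 * u $ 2 * A12 P x"
  using pairing_derivative[OF assms C2_on_D[OF C2_g1 assms(2)]]
  by (intro total_deriv_eq[OF assms(1)]) (simp add: xi1_eq b1_def A11_def A12_def)

text \<open>The total derivative of \<open>xi1\<close> is affine in \<open>w\<close> with slope
  \<open>A11 P x > 0\<close>, so the description picks its only zero.\<close>

lemma u1_dot_eq: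
  assumes "t \<in> {0..horizon P}" "x \<in> U" "stationary t x u"
  shows "u1_dot P t x (closed_costate P t x) u = (b1 P t x (u $ 1) + u $ 1 * u $ 2 * A12 P x) / A11 P x"
  unfolding u1_dot_def total_deriv_xi1[OF assms]
  using A11_pos[OF assms(2)] by (intro the_equality) (simp_all add: field_simps)

lemma xi2_dot_stationary:
  assumes "x \<in> U" "stationary t x u"
  shows "closed_costate P t x \<bullet> g12 P x = bil (Mrun P) (err' P t x u) (b x)"
  unfolding closed_costate_stationary[OF assms] lies_eq[OF C2_on_D[OF C2_phi assms(1)]] ..

text \<open>\<open>pairing_derivative\<close> for the bracket field, multiplied by the varying
  factor \<open>u $ 1\<close>. The product-rule term with the derivative of that factor vanishes by
  \<open>xi2_dot_stationary\<close>.\<close>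

lemma total_deriv_xi2_dot:
  assumes "t \<in> {0..horizon P}" "x \<in> U" "stationary t x u"
  shows "total_deriv P (xi2_dot P) t x (closed_costate P t x) u w
    = (- b2 P t x (u $ 1) + w * A21 P x - u $ 1 * u $ 2 * A22 P x) * u $ 1"
proof (rule total_deriv_eq[OF assms(1)])
  let ?S = "{- t..horizon P - t}"
  have u1: "((\<lambda>s. (u + s *\<^sub>R axis 1 w) $ 1) has_vector_derivative w) (at 0 within ?S)"
    by (auto intro!: derivative_eq_intros simp: has_vector_derivative_def axis_def)
  show "((\<lambda>s. xi2_dot P (t + s) (x + s *\<^sub>R sys P x u)
        (closed_costate P t x + s *\<^sub>R costate_rhs P t x (closed_costate P t x) u) (u + s *\<^sub>R axis 1 w))
      has_vector_derivative (- b2 P t x (u $ 1) + w * A21 P x - u $ 1 * u $ 2 * A22 P x) * u $ 1) (at 0 within ?S)"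
    using has_vector_derivative_mult[OF pairing_derivative[OF assms g12_derivative[OF assms(2)], of w] u1]
    by (simp add: xi2_dot_def b2_def A21_def A22_def xi2_dot_stationary[OF assms(2,3)])
qed

text \<open>Eliminating \<open>w\<close> leaves, up to sign and powers of \<open>u $ 1\<close>, the
  Schur complement of \<open>A11 P x\<close> in the Gram matrix as coefficient of
  \<open>u $ 2\<close>.\<close>

lemma xi2_ddot_eq:
  assumes "t \<in> {0..horizon P}" "x \<in> U" "stationary t x u"
  shows "xi2_ddot P t x (closed_costate P t x) u =
    (A21 P x * b1 P t x (u $ 1) / A11 P x - b2 P t x (u $ 1)
      - u $ 1 * u $ 2 * ((A11 P x * A22 P x - A12 P x * A21 P x) / A11 P x)) * u $ 1"
  unfolding xi2_ddot_def total_deriv_xi2_dot[OF assms] u1_dot_eq[OF assms]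
  using A11_pos[OF assms(2)] by (simp add: field_simps)

text \<open>Moving \<open>u\<close> along the second axis preserves stationarity, so
  \<open>xi2_ddot_eq\<close> applies on the whole line and the function is affine there.\<close>

lemma xi2_ddot_u2:
  assumes "t \<in> {0..horizon P}" "x \<in> U" "stationary t x u"
  shows "- pd 2 (xi2_ddot P t x (closed_costate P t x)) u
    = (u $ 1)\<^sup>2 * ((A11 P x * A22 P x - A12 P x * A21 P x) / A11 P x)"
proof -
  define c where "c = A21 P x * b1 P t x (u $ 1) / A11 P x - b2 P t x (u $ 1)"
  define K where "K = (A11 P x * A22 P x - A12 P x * A21 P x) / A11 P x"
  have "xi2_ddot P t x (closed_costate P t x) (u + s *\<^sub>R axis 2 1) =
    (c - u $ 1 * (u $ 2 + s) * K) * u $ 1" for s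
  proof -
    have u: "(u + s *\<^sub>R axis 2 1) $ 1 = u $ 1" "(u + s *\<^sub>R axis 2 1) $ 2 = u $ 2 + s"
      by (simp_all add: axis_def)
    have "stationary t x (u + s *\<^sub>R axis 2 1)" using assms(3) stationary_cong[OF u(1)] by blast
    from xi2_ddot_eq[OF assms(1,2) this] show ?thesis unfolding u c_def K_def .
  qed
  moreover have "((\<lambda>s. (c - u $ 1 * (u $ 2 + s) * K) * u $ 1) has_real_derivative - (u $ 1 * K * u $ 1)) (at 0)"
    by (auto intro!: derivative_eq_intros)
  ultimately show ?thesis
    unfolding pd_def K_def[symmetric] by (simp add: DERIV_imp_deriv power2_eq_square)
qed

section \<open>The closed-form costate under the control law\<close>

lemma xi1_closed:
  assumes "x \<in> U"
  shows "xi1 P t x (closed_costate P t x) u = A11 P x * (u $ 1 - u1_sing P t x)"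
  using A11_pos[OF assms]
  unfolding xi1_eq closed_costate_inner[OF assms] lies_eq[OF C2_on_D[OF C2_phi assms], symmetric] err'_def
  by (simp add: u1_sing_def bil_simps A11_def[symmetric] field_simps)

text \<open>The closed costate is a combination of the differentials of the components of
  \<open>phi P\<close>, which annihilate \<open>g2 P\<close>.\<close>

lemma xi2_closed: "x \<in> U \<Longrightarrow> xi2 P t x (closed_costate P t x) u = 0"
  using lies_g2[of x]
  by (simp add: xi2_eq closed_costate_inner lies_eq[OF C2_on_D[OF C2_phi], symmetric] bil_simps)

lemma xi2_dot_closed_eq: "xi2_dot P t x (closed_costate P t x) u = xi2_dot_closed P t x (u $ 1)"
  using err'_cong[of u "axis 1 (u $ 1)" t x] by (simp add: xi2_dot_closed_def xi2_dot_def)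

lemma singular_conditionsI:
  assumes t: "t \<in> {0..horizon P}" and x: "x \<in> U" and u1: "u $ 1 \<noteq> 0"
    and sing1: "u $ 1 = u1_sing P t x" and dot: "xi2_dot_closed P t x (u $ 1) = 0"
    and sing2: "u $ 2 = u2_sing P t x (u $ 1)"
  shows "singular_conditions P t x (closed_costate P t x) u" and "stationary t x u"
proof -
  have xi1: "xi1 P t x (closed_costate P t x) u = 0" by (simp add: xi1_closed[OF x] sing1)
  have xi2d: "xi2_dot P t x (closed_costate P t x) u = 0" using dot by (simp add: xi2_dot_closed_eq)
  \<comment> \<open>\<open>xi2_dot\<close> carries a factor \<open>u $ 1\<close>; cancelling it, as
    \<open>u $ 1\<close> is nonzero, gives the second orthogonality relation.\<close>
  show st: "stationary t x u"
    using xi1 xi2d u1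
    unfolding xi1_eq xi2_dot_def closed_costate_inner[OF x] lies_eq[OF C2_on_D[OF C2_phi x], symmetric]
    by (intro stationaryI[OF x]) auto
  define \<Delta> where "\<Delta> = A11 P x * A22 P x - A12 P x * A21 P x"
  have pos: "\<Delta> > 0" "A11 P x > 0" using A_det_pos[OF x] A11_pos[OF x] by (auto simp: \<Delta>_def)
  \<comment> \<open>The denominator in \<open>u2_sing\<close> is the negative Gram determinant times
    \<open>u $ 1\<close>, hence nonzero.\<close>
  have "A12 P x * A21 P x - A11 P x * A22 P x = - \<Delta>" by (simp add: \<Delta>_def)
  then have "u $ 2 = (A11 P x * b2 P t x (u $ 1) - A21 P x * b1 P t x (u $ 1)) / (- \<Delta> * u $ 1)"
    using sing2 unfolding u2_sing_def by simp
  then have "u $ 1 * u $ 2 * \<Delta> = A21 P x * b1 P t x (u $ 1) - A11 P x * b2 P t x (u $ 1)"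
    using u1 pos by (simp add: field_simps)
  then have "u $ 1 * u $ 2 * (\<Delta> / A11 P x) = A21 P x * b1 P t x (u $ 1) / A11 P x - b2 P t x (u $ 1)"
    using pos by (simp add: field_simps)
  then have "xi2_ddot P t x (closed_costate P t x) u = 0"
    unfolding xi2_ddot_eq[OF t x st] \<Delta>_def[symmetric] by simp
  moreover have "- pd 2 (xi2_ddot P t x (closed_costate P t x)) u > 0"
    unfolding xi2_ddot_u2[OF t x st] \<Delta>_def[symmetric] using pos u1 by simp
  ultimately show "singular_conditions P t x (closed_costate P t x) u"
    unfolding singular_conditions_def hamiltonian_uu xi2_closed[OF x]
    using xi1 xi2d pos by simp
qed

end

section \<open>The control law\<close>

theorem mainTheorem2:
  fixes P :: ocp and U :: "(real^3) set" and x0 :: "real^3"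
    and x :: "real \<Rightarrow> real^3" and u :: "real \<Rightarrow> real^2"
  assumes "open U"
    and "smooth_on U (g1 P)" and "smooth_on U (g2 P)" and "smooth_on U (phi P)"
    and "x_flat U (sys P) (phi P)"
    and "\<forall>z\<in>U. \<forall>i. lie (g2 P) (\<lambda>w. phi P w $ i) z = 0"
    and "\<forall>z\<in>U. det (vector
          [vector [lie (g1 P) (\<lambda>w. phi P w $ 1) z, lie (g12 P) (\<lambda>w. phi P w $ 1) z],
           vector [lie (g1 P) (\<lambda>w. phi P w $ 2) z, lie (g12 P) (\<lambda>w. phi P w $ 2) z]] :: real^2^2) \<noteq> 0"
    and "0 < horizon P" and "smooth_on {0..horizon P} (yd P)"
    and "sym_pos_def (Qbar P)" and "sym_pos_def (Qrun P)" and "sym_pos_def (Mrun P)"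
    and "Qrun P = Qbar P ** matrix_inv (Mrun P) ** Qbar P"
    and "\<forall>a. 0 < umax P $ a"
    and "controlled_trajectory P U x0 x u"
    and "\<forall>t\<in>{0..horizon P}. u t $ 1 = u1_law P t (x t)"
    and "\<forall>t\<in>{0..horizon P}. u t $ 2 = u2_law P t (x t) (u t $ 1)"
    and "\<forall>t\<in>{0..horizon P}. u t $ 1 \<noteq> 0"
  shows "optimal_candidate P U x0 x (\<lambda>t. closed_costate P t (x t)) u"
proof -
  have T: "0 < horizon P" and umax: "\<And>i. 0 < umax P $ i" using assms(8,14) by auto
  have C2: "C2_on U (g1 P)" "C2_on U (g2 P)" "C2_on U (phi P)"
    using smooth_on_imp_C2_on[OF assms(1)] assms(2-4) by auto
  have det: "lies (g1 P) (phi P) z $ 1 * lies (g12 P) (phi P) z $ 2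
        - lies (g12 P) (phi P) z $ 1 * lies (g1 P) (phi P) z $ 2 \<noteq> 0" if "z \<in> U" for z
    using assms(7)[rule_format, OF that] by (simp add: det_2 lies_def)
  interpret flat_tracking P U
    by unfold_locales (use C2 assms(6,8-10,12,13) det in \<open>auto simp: lies_def vec_eq_iff\<close>)
  have inU: "x t \<in> U" if "t \<in> {0..horizon P}" for t
    using assms(15) that unfolding controlled_trajectory_def by blast
  obtain Z where Z: "negligible Z" and ode: "\<And>t. t \<in> {0..horizon P} - Z \<Longrightarrow>
      (x has_vector_derivative sys P (x t) (u t)) (at t within {0..horizon P})"
    using assms(15) unfolding controlled_trajectory_def by blast
  have sat: "\<bar>sgn r * umax P $ i\<bar> = umax P $ i" if "r \<noteq> 0" for r i
    using that umax[of i] by (simp add: abs_mult abs_sgn_eq)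
  \<comment> \<open>The positive bound excludes \<open>r = 0\<close>, where \<open>sgn\<close> would
    return 0 instead of a saturated value.\<close>
  have sat': "\<bar>sgn r * umax P $ i\<bar> = umax P $ i" if "\<bar>r\<bar> \<ge> umax P $ i" for r i
    using that umax[of i] by (intro sat) auto
  \<comment> \<open>Each input is either on its bound or follows the singular branch of its law; the
    pointwise conditions below are read off this dichotomy and its analogue for
    \<open>u t $ 2\<close>.\<close>
  have u1: "\<bar>u t $ 1\<bar> = umax P $ 1 \<or> \<bar>u t $ 1\<bar> < umax P $ 1 \<and> u t $ 1 = u1_sing P t (x t)"
    if "t \<in> {0..horizon P}" for t
    using assms(16)[rule_format, OF that] sat'[of 1 "u1_sing P t (x t)"]
    by (auto simp: u1_law_def not_le split: if_splits)
  have u2: "\<bar>u t $ 2\<bar> = umax P $ 2 \<or> \<bar>u t $ 2\<bar> < umax P $ 2 \<and>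
      xi2_dot_closed P t (x t) (u t $ 1) = 0 \<and> u t $ 2 = u2_sing P t (x t) (u t $ 1)"
    if "t \<in> {0..horizon P}" for t
    using assms(17)[rule_format, OF that] sat'[of 2 "u2_sing P t (x t) (u t $ 1)"]
      sat[of "xi2_dot_closed P t (x t) (u t $ 1)" 2]
    by (auto simp: u2_law_def not_le split: if_splits)
  have singular: "singular_conditions P t (x t) (closed_costate P t (x t)) (u t)" "stationary t (x t) (u t)"
    if t: "t \<in> {0..horizon P}" and interior: "\<forall>i. \<bar>u t $ i\<bar> < umax P $ i" for t
  proof -
    have "u t $ 1 = u1_sing P t (x t)" "xi2_dot_closed P t (x t) (u t $ 1) = 0"
      "u t $ 2 = u2_sing P t (x t) (u t $ 1)"
      using u1[OF t] u2[OF t] interior[rule_format, of 1] interior[rule_format, of 2] by auto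
    from singular_conditionsI[OF t inU[OF t] assms(18)[rule_format, OF t] this]
    show "singular_conditions P t (x t) (closed_costate P t (x t)) (u t)" "stationary t (x t) (u t)" .
  qed
  show ?thesis
    unfolding optimal_candidate_def
  proof (intro conjI ballI)
    show "controlled_trajectory P U x0 x u" by (rule assms(15))
    show "\<forall>i. \<bar>u t $ i\<bar> \<le> umax P $ i" if "t \<in> {0..horizon P}" for t
      using u1[OF that] u2[OF that] by (auto simp: forall_2)
    show "closed_costate P (horizon P) (x (horizon P)) = (\<chi> k. - bil (Qbar P)
        (err P (horizon P) (x (horizon P))) (pds k (phi P) (x (horizon P))))"
      by (simp add: closed_costate_def)
    show "\<exists>Z. negligible Z \<and> (\<forall>t\<in>{0..horizon P} - Z. (\<forall>i. \<bar>u t $ i\<bar> < umax P $ i) \<longrightarrow>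
        ((\<lambda>t. closed_costate P t (x t)) has_vector_derivative
          costate_rhs P t (x t) (closed_costate P t (x t)) (u t)) (at t within {0..horizon P}))"
    \<comment> \<open>The costate equation can fail only where the state equation does, so the same
      null set serves.\<close>
    proof (intro exI[of _ Z] conjI Z ballI impI)
      fix t assume t: "t \<in> {0..horizon P} - Z" and "\<forall>i. \<bar>u t $ i\<bar> < umax P $ i"
      then have "stationary t (x t) (u t)" using singular(2) by blast
      then show "((\<lambda>t. closed_costate P t (x t)) has_vector_derivative
          costate_rhs P t (x t) (closed_costate P t (x t)) (u t)) (at t within {0..horizon P})"
        using costate_equation[OF inU _ ode[OF t]] t by blast
    qed
    fix t assume t: "t \<in> {0..horizon P}"
    show "(\<forall>i. \<bar>u t $ i\<bar> < umax P $ i) \<longrightarrow>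
        singular_conditions P t (x t) (closed_costate P t (x t)) (u t)"
      using singular(1)[OF t] by blast
    \<comment> \<open>By \<open>xi1_closed\<close>, a nonzero \<open>xi1\<close> rules out the
      singular branch.\<close>
    show "xi1 P t (x t) (closed_costate P t (x t)) (u t) \<noteq> 0 \<longrightarrow> \<bar>u t $ 1\<bar> = umax P $ 1"
      using u1[OF t] by (auto simp: xi1_closed[OF inU[OF t]])
    show "xi2 P t (x t) (closed_costate P t (x t)) (u t) \<noteq> 0 \<or>
        xi2_dot P t (x t) (closed_costate P t (x t)) (u t) \<noteq> 0 \<longrightarrow> \<bar>u t $ 2\<bar> = umax P $ 2"
      using u2[OF t] by (auto simp: xi2_closed[OF inU[OF t]] xi2_dot_closed_eq)
  qed
qed

end
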